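(* Let $(M,g)$ be a light-like manifold with constant index and nullity degree $r$. Assume that $Rad(TM)$ is a trivial bundle, with everywhere linearly independent vector fields $\xi_i\in\Gamma(Rad(TM))$, $i=1,\dots,r$. Let $\tau_i$ ($i=1,\dots,r$) be smooth 1-forms on $M$ satisfying $\tau_i(\xi_j)=\delta_{ij}$ for $i,j=1,\dots,r$. Let $T$ be a torsion tensor (an anti-symmetric $(1,2)$-tensor field) on $M$ satisfying, for all $X,Y\in\Gamma(TM)$ and $i=1,\dots,r$, $$(d\tau_i)(X,Y)=\tau_i(T(X,Y))\quad\text{and}\quad (L_{\xi_i}g)(X,Y)=g(X,T(\xi_i,Y))+g(Y,T(\xi_i,X)).$$ Then there exists a unique linear connection $\nabla$ on $M$ compatible with $g$ (i.e. $\nabla g=0$), having torsion $T$, and making the 1-forms $\tau_i$ parallel (i.e. $\nabla_X\tau_i=0$ for all $X\in\Gamma(TM)$, $i=1,\dots,r$).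
   Context: A light-like manifold $(M,g)$ is a smooth manifold $M$ with a smooth symmetric $(0,2)$-tensor field $g$ of constant index and constant nullity degree (co-rank). $Rad(TM)$ is the radical of $g$: the subbundle of $TM$ with fibres $Rad(T_xM)=\{v\in T_xM : g(v,w)=0 \text{ for all } w\in T_xM\}$; its rank equals the nullity degree. $\Gamma(E)$ denotes the space of smooth sections of a bundle $E$. $L$ denotes the Lie derivative. The torsion of a linear connection $\nabla$ is $T(X,Y)=\nabla_XY-\nabla_YX-[X,Y]$. Conventions: $(d\tau)(X,Y)=X\tau(Y)-Y\tau(X)-\tau([X,Y])$, $(\nabla_Zg)(X,Y)=Z(g(X,Y))-g(\nabla_ZX,Y)-g(X,\nabla_ZY)$, $(\nabla_X\tau)(Y)=X(\tau(Y))-\tau(\nabla_XY)$, $(L_\xi g)(X,Y)=\xi(g(X,Y))-g([\xi,X],Y)-g(X,[\xi,Y])$. *)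

theory Defs
  imports "HOL-Analysis.Analysis"
begin

subsection \<open>Smooth manifolds\<close>

primrec Ck_on :: "nat \<Rightarrow> 'a::euclidean_space set \<Rightarrow> ('a \<Rightarrow> 'b::real_normed_vector) \<Rightarrow> bool" where
  "Ck_on 0 S f \<longleftrightarrow> continuous_on S f"
| "Ck_on (Suc k) S f \<longleftrightarrow> (\<forall>x\<in>S. f differentiable at x) \<and>
     (\<forall>v. Ck_on k S (\<lambda>x. frechet_derivative f (at x) v))"

(* Only meaningful for open S. *)
definition smooth_on :: "'a::euclidean_space set \<Rightarrow> ('a \<Rightarrow> 'b::real_normed_vector) \<Rightarrow> bool" where
  "smooth_on S f \<longleftrightarrow> (\<forall>k. Ck_on k S f)"

(* A chart is a domain together with a coordinate map.  The manifold is the whole type 'm,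
   modelled on the Euclidean space 'e; its dimension DIM('e) is arbitrary but positive. *)
type_synonym ('m, 'e) chart = "'m set \<times> ('m \<Rightarrow> 'e)"

definition chart_inv :: "('m, 'e) chart \<Rightarrow> 'e \<Rightarrow> 'm" where
  "chart_inv c = inv_into (fst c) (snd c)"

definition chart_image :: "('m, 'e) chart \<Rightarrow> 'e set" where
  "chart_image c = snd c ` fst c"

definition is_chart :: "('m::topological_space, 'e::euclidean_space) chart \<Rightarrow> bool" where
  "is_chart c \<longleftrightarrow> open (fst c) \<and> open (chart_image c) \<and>
     homeomorphism (fst c) (chart_image c) (snd c) (chart_inv c)"

definition smooth_manifold ::
  "('m::{t2_space, second_countable_topology}, 'e::euclidean_space) chart set \<Rightarrow> bool" where
  "smooth_manifold A \<longleftrightarrow> (\<forall>c\<in>A. is_chart c) \<and> (\<Union>c\<in>A. fst c) = UNIV \<and>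
     (\<forall>c\<in>A. \<forall>d\<in>A. smooth_on (snd c ` (fst c \<inter> fst d)) (snd d \<circ> chart_inv c))"

definition smooth_fun :: "('m, 'e::euclidean_space) chart set \<Rightarrow> ('m \<Rightarrow> real) \<Rightarrow> bool" where
  "smooth_fun A f \<longleftrightarrow> (\<forall>c\<in>A. smooth_on (chart_image c) (f \<circ> chart_inv c))"

subsection \<open>Tangent vectors and tensor fields\<close>

(* The tangent space at x is the vector space 'e: a vector v at x stands for the tangent vector
   whose components in the selected chart chart_at A x around x are v.  Components in another
   chart are obtained by the derivative of the coordinate change.  The selection may jump from
   point to point, so a smooth vector field is in general not smooth as a map 'm => 'e;
   smoothness always refers to components in a fixed chart of the atlas. *)
definition chart_at :: "('m, 'e) chart set \<Rightarrow> 'm \<Rightarrow> ('m, 'e) chart" where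
  "chart_at A x = (SOME c. c \<in> A \<and> x \<in> fst c)"

(* Components in the chart c of the tangent vector v at x. *)
definition components ::
  "('m, 'e::euclidean_space) chart set \<Rightarrow> ('m, 'e) chart \<Rightarrow> 'm \<Rightarrow> 'e \<Rightarrow> 'e" where
  "components A c x v =
     frechet_derivative (snd c \<circ> chart_inv (chart_at A x)) (at (snd (chart_at A x) x)) v"

(* The tangent vector at x whose components in the chart c are u; for u running through a basis
   these are the coordinate vector fields of c. *)
definition coord_vector ::
  "('m, 'e::euclidean_space) chart set \<Rightarrow> ('m, 'e) chart \<Rightarrow> 'e \<Rightarrow> 'm \<Rightarrow> 'e" where
  "coord_vector A c u x = frechet_derivative (snd (chart_at A x) \<circ> chart_inv c) (at (snd c x)) u"

definition local_rep ::
  "('m, 'e::euclidean_space) chart set \<Rightarrow> ('m, 'e) chart \<Rightarrow> ('m \<Rightarrow> 'e) \<Rightarrow> 'e \<Rightarrow> 'e" where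
  "local_rep A c X y = components A c (chart_inv c y) (X (chart_inv c y))"

definition vector_fields :: "('m, 'e::euclidean_space) chart set \<Rightarrow> ('m \<Rightarrow> 'e) set" where
  "vector_fields A = {X. \<forall>c\<in>A. smooth_on (chart_image c) (local_rep A c X)}"

definition one_form ::
  "('m, 'e::euclidean_space) chart set \<Rightarrow> ('m \<Rightarrow> 'e \<Rightarrow> real) \<Rightarrow> bool" where
  "one_form A \<tau> \<longleftrightarrow> (\<forall>x. linear (\<tau> x)) \<and>
     (\<forall>c\<in>A. \<forall>u. smooth_on (chart_image c)
        ((\<lambda>x. \<tau> x (coord_vector A c u x)) \<circ> chart_inv c))"

definition symmetric_tensor_field ::
  "('m, 'e::euclidean_space) chart set \<Rightarrow> ('m \<Rightarrow> 'e \<Rightarrow> 'e \<Rightarrow> real) \<Rightarrow> bool" where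
  "symmetric_tensor_field A g \<longleftrightarrow>
     (\<forall>x. bilinear (g x)) \<and> (\<forall>x v w. g x v w = g x w v) \<and>
     (\<forall>c\<in>A. \<forall>u w. smooth_on (chart_image c)
        ((\<lambda>x. g x (coord_vector A c u x) (coord_vector A c w x)) \<circ> chart_inv c))"

(* Anti-symmetric (1,2)-tensor fields. *)
definition torsion_tensor ::
  "('m, 'e::euclidean_space) chart set \<Rightarrow> ('m \<Rightarrow> 'e \<Rightarrow> 'e \<Rightarrow> 'e) \<Rightarrow> bool" where
  "torsion_tensor A T \<longleftrightarrow>
     (\<forall>x. bilinear (T x)) \<and> (\<forall>x v w. T x v w = - T x w v) \<and>
     (\<forall>c\<in>A. \<forall>u w. smooth_on (chart_image c)
        (local_rep A c (\<lambda>x. T x (coord_vector A c u x) (coord_vector A c w x))))"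

subsection \<open>Light-like metrics\<close>

definition Rad :: "('m \<Rightarrow> 'e::euclidean_space \<Rightarrow> 'e \<Rightarrow> real) \<Rightarrow> 'm \<Rightarrow> 'e set" where
  "Rad g x = {v. \<forall>w. g x v w = 0}"

definition Rad_sections ::
  "('m, 'e::euclidean_space) chart set \<Rightarrow> ('m \<Rightarrow> 'e \<Rightarrow> 'e \<Rightarrow> real) \<Rightarrow> ('m \<Rightarrow> 'e) set" where
  "Rad_sections A g = {X \<in> vector_fields A. \<forall>x. X x \<in> Rad g x}"

definition metric_index :: "('m \<Rightarrow> 'e::euclidean_space \<Rightarrow> 'e \<Rightarrow> real) \<Rightarrow> 'm \<Rightarrow> nat" where
  "metric_index g x =
     Max {dim W | W. subspace W \<and> (\<forall>w\<in>W. w \<noteq> 0 \<longrightarrow> g x w w < 0)}"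

(* Here q is the constant index and r the constant nullity degree. *)
definition light_like_manifold ::
  "('m::{t2_space, second_countable_topology}, 'e::euclidean_space) chart set \<Rightarrow>
   ('m \<Rightarrow> 'e \<Rightarrow> 'e \<Rightarrow> real) \<Rightarrow> nat \<Rightarrow> nat \<Rightarrow> bool" where
  "light_like_manifold A g q r \<longleftrightarrow> smooth_manifold A \<and> symmetric_tensor_field A g \<and>
     (\<forall>x. metric_index g x = q) \<and> (\<forall>x. dim (Rad g x) = r)"

subsection \<open>Differential operators\<close>

(* The derivative X(f) of a function along a vector field. *)
definition dir_deriv ::
  "('m, 'e::euclidean_space) chart set \<Rightarrow> ('m \<Rightarrow> 'e) \<Rightarrow> ('m \<Rightarrow> real) \<Rightarrow> 'm \<Rightarrow> real" where
  "dir_deriv A X f x =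
     frechet_derivative (f \<circ> chart_inv (chart_at A x)) (at (snd (chart_at A x) x)) (X x)"

(* [X,Y]^i = X^j d_j Y^i - Y^j d_j X^i, computed in the chart selected at the point. *)
definition lie_bracket ::
  "('m, 'e::euclidean_space) chart set \<Rightarrow> ('m \<Rightarrow> 'e) \<Rightarrow> ('m \<Rightarrow> 'e) \<Rightarrow> 'm \<Rightarrow> 'e" where
  "lie_bracket A X Y x =
     (let c = chart_at A x in
        frechet_derivative (local_rep A c Y) (at (snd c x)) (X x)
      - frechet_derivative (local_rep A c X) (at (snd c x)) (Y x))"

definition ext_deriv ::
  "('m, 'e::euclidean_space) chart set \<Rightarrow> ('m \<Rightarrow> 'e \<Rightarrow> real) \<Rightarrow>
   ('m \<Rightarrow> 'e) \<Rightarrow> ('m \<Rightarrow> 'e) \<Rightarrow> 'm \<Rightarrow> real" where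
  "ext_deriv A \<tau> X Y x =
     dir_deriv A X (\<lambda>z. \<tau> z (Y z)) x - dir_deriv A Y (\<lambda>z. \<tau> z (X z)) x
     - \<tau> x (lie_bracket A X Y x)"

definition lie_deriv_metric ::
  "('m, 'e::euclidean_space) chart set \<Rightarrow> ('m \<Rightarrow> 'e) \<Rightarrow> ('m \<Rightarrow> 'e \<Rightarrow> 'e \<Rightarrow> real) \<Rightarrow>
   ('m \<Rightarrow> 'e) \<Rightarrow> ('m \<Rightarrow> 'e) \<Rightarrow> 'm \<Rightarrow> real" where
  "lie_deriv_metric A Z g X Y x =
     dir_deriv A Z (\<lambda>z. g z (X z) (Y z)) x
     - g x (lie_bracket A Z X x) (Y x) - g x (X x) (lie_bracket A Z Y x)"

subsection \<open>Linear connections\<close>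

(* A connection is only meant to act on smooth vector fields; the extensional function space
   fixes its (irrelevant) value on all other arguments, so that equality of connections is
   equality on smooth vector fields.  Linearity over the reals is the case of constant f. *)
definition linear_connection ::
  "('m, 'e::euclidean_space) chart set \<Rightarrow> (('m \<Rightarrow> 'e) \<Rightarrow> ('m \<Rightarrow> 'e) \<Rightarrow> 'm \<Rightarrow> 'e) \<Rightarrow> bool" where
  "linear_connection A D \<longleftrightarrow>
     D \<in> vector_fields A \<rightarrow>\<^sub>E (vector_fields A \<rightarrow>\<^sub>E vector_fields A) \<and>
     (\<forall>X\<in>vector_fields A. \<forall>X'\<in>vector_fields A. \<forall>Y\<in>vector_fields A.
        \<forall>x. D (\<lambda>z. X z + X' z) Y x = D X Y x + D X' Y x) \<and>
     (\<forall>X\<in>vector_fields A. \<forall>Y\<in>vector_fields A. \<forall>Y'\<in>vector_fields A.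
        \<forall>x. D X (\<lambda>z. Y z + Y' z) x = D X Y x + D X Y' x) \<and>
     (\<forall>f. smooth_fun A f \<longrightarrow> (\<forall>X\<in>vector_fields A. \<forall>Y\<in>vector_fields A.
        \<forall>x. D (\<lambda>z. f z *\<^sub>R X z) Y x = f x *\<^sub>R D X Y x)) \<and>
     (\<forall>f. smooth_fun A f \<longrightarrow> (\<forall>X\<in>vector_fields A. \<forall>Y\<in>vector_fields A.
        \<forall>x. D X (\<lambda>z. f z *\<^sub>R Y z) x = dir_deriv A X f x *\<^sub>R Y x + f x *\<^sub>R D X Y x))"

definition torsion ::
  "('m, 'e::euclidean_space) chart set \<Rightarrow> (('m \<Rightarrow> 'e) \<Rightarrow> ('m \<Rightarrow> 'e) \<Rightarrow> 'm \<Rightarrow> 'e) \<Rightarrow>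
   ('m \<Rightarrow> 'e) \<Rightarrow> ('m \<Rightarrow> 'e) \<Rightarrow> 'm \<Rightarrow> 'e" where
  "torsion A D X Y x = D X Y x - D Y X x - lie_bracket A X Y x"

definition cov_deriv_metric ::
  "('m, 'e::euclidean_space) chart set \<Rightarrow> (('m \<Rightarrow> 'e) \<Rightarrow> ('m \<Rightarrow> 'e) \<Rightarrow> 'm \<Rightarrow> 'e) \<Rightarrow>
   ('m \<Rightarrow> 'e) \<Rightarrow> ('m \<Rightarrow> 'e \<Rightarrow> 'e \<Rightarrow> real) \<Rightarrow> ('m \<Rightarrow> 'e) \<Rightarrow> ('m \<Rightarrow> 'e) \<Rightarrow> 'm \<Rightarrow> real" where
  "cov_deriv_metric A D Z g X Y x =
     dir_deriv A Z (\<lambda>z. g z (X z) (Y z)) x - g x (D Z X x) (Y x) - g x (X x) (D Z Y x)"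

definition cov_deriv_form ::
  "('m, 'e::euclidean_space) chart set \<Rightarrow> (('m \<Rightarrow> 'e) \<Rightarrow> ('m \<Rightarrow> 'e) \<Rightarrow> 'm \<Rightarrow> 'e) \<Rightarrow>
   ('m \<Rightarrow> 'e) \<Rightarrow> ('m \<Rightarrow> 'e \<Rightarrow> real) \<Rightarrow> ('m \<Rightarrow> 'e) \<Rightarrow> 'm \<Rightarrow> real" where
  "cov_deriv_form A D X \<tau> Y x = dir_deriv A X (\<lambda>z. \<tau> z (Y z)) x - \<tau> x (D X Y x)"

end

theory Submission
  imports Defs
begin

text \<open>
  The degenerate metric is completed by the given forms: \<open>h = g + \<Sum>\<^sub>i \<tau>\<^sub>i \<otimes> \<tau>\<^sub>i\<close> is a nondegenerate
  symmetric tensor field (\<open>completed_metric_nondegenerate\<close>), because a vector \<open>h\<close>-orthogonal to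
  everything is killed by all \<open>\<tau>\<^sub>i = h(\<xi>\<^sub>i, -)\<close> and lies in the radical of \<open>g\<close>, on which the
  \<open>\<tau>\<^sub>i\<close> are coordinates.  For a nondegenerate \<open>h\<close> and a torsion tensor \<open>T\<close> there is exactly one linear
  connection with \<open>\<nabla>h = 0\<close> and torsion \<open>T\<close>, given by the Koszul formula.  If \<open>g\<close> and the \<open>\<tau>\<^sub>i\<close> are
  parallel, so is \<open>h\<close>; this gives uniqueness.

  Conversely, the connection of \<open>h\<close> and \<open>T\<close> is the desired one.  The hypotheses on \<open>d\<tau>\<^sub>i\<close> and on
  the Lie derivative of \<open>g\<close> along \<open>\<xi>\<^sub>i\<close> make the Koszul expression for \<open>h(\<nabla>\<^sub>X \<xi>\<^sub>i, Z)\<close> vanish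
  (\<open>koszul_connection_\<xi>\<close>).  So \<open>\<xi>\<^sub>i\<close> is parallel, hence so is \<open>\<tau>\<^sub>i = h(\<xi>\<^sub>i, -)\<close>, and then also
  \<open>g = h - \<Sum>\<^sub>i \<tau>\<^sub>i \<otimes> \<tau>\<^sub>i\<close>.

  The connection is defined at each point by Christoffel symbols in the chart selected there, so
  that \<open>\<nabla>h = 0\<close>, the torsion and the Leibniz rule are pointwise linear algebra.  The analytic
  content is that \<open>\<nabla>\<^sub>X Y\<close> is a smooth vector field (\<open>vector_field_koszul_connection\<close>).  It rests on
  three facts: the Lie bracket of vector fields is a vector field, by the symmetry of second
  derivatives (\<open>vector_field_lie_bracket\<close>); coordinate fields multiplied by bump functions are
  global vector fields (\<open>vector_field_bump_field\<close>); and the solution of a linear system with smooth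
  coefficients is smooth (\<open>Ck_on_linear_system_solution\<close>).
\<close>

section \<open>Calculus of smooth maps between Euclidean spaces\<close>

lemma Ck_on_Suc_has_derivative:
  "Ck_on (Suc k) S f \<Longrightarrow> x \<in> S \<Longrightarrow> (f has_derivative frechet_derivative f (at x)) (at x)"
  by (simp add: frechet_derivative_works)

lemma Ck_on_cong:
  assumes "open S" "\<And>x. x \<in> S \<Longrightarrow> f x = g x" "Ck_on k S f"
  shows "Ck_on k S g"
  using assms(2,3)
proof (induction k arbitrary: f g)
  case 0
  then show ?case by (simp cong: continuous_on_cong)
next
  case (Suc k)
  have D: "(g has_derivative frechet_derivative f (at x)) (at x)" if "x \<in> S" for x
    by (rule has_derivative_transform_within_open[OF
          Ck_on_Suc_has_derivative[OF Suc.prems(2) that] \<open>open S\<close> that]) (use Suc.prems in auto)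
  then have eq: "frechet_derivative f (at x) = frechet_derivative g (at x)" if "x \<in> S" for x
    using frechet_derivative_at that by blast
  have "Ck_on k S (\<lambda>x. frechet_derivative g (at x) v)" for v
    by (rule Suc.IH[where f = "\<lambda>x. frechet_derivative f (at x) v"]) (use Suc.prems eq in auto)
  with D show ?case unfolding Ck_on.simps differentiable_def by blast
qed

lemma Ck_on_SucI:
  assumes "open S" "\<And>x. x \<in> S \<Longrightarrow> (f has_derivative f' x) (at x)"
    and "\<And>v. Ck_on k S (\<lambda>x. f' x v)"
  shows "Ck_on (Suc k) S f"
proof -
  have "f' x = frechet_derivative f (at x)" if "x \<in> S" for x
    using frechet_derivative_at assms(2) that by blast
  then have "Ck_on k S (\<lambda>x. frechet_derivative f (at x) v)" for v
    by (intro Ck_on_cong[OF assms(1) _ assms(3)[of v]]) simp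
  then show ?thesis
    using assms(2) unfolding Ck_on.simps differentiable_def by blast
qed

lemma Ck_on_subset: "Ck_on k S f \<Longrightarrow> U \<subseteq> S \<Longrightarrow> Ck_on k U f"
  by (induction k arbitrary: f) (auto intro: continuous_on_subset)

lemma Ck_on_imp_continuous_on: "Ck_on k S f \<Longrightarrow> continuous_on S f"
proof (cases k)
  case (Suc j)
  assume "Ck_on k S f"
  then show ?thesis unfolding Suc
    by (auto intro!: continuous_at_imp_continuous_on differentiable_imp_continuous_within)
qed simp

lemma Ck_on_SucD: "Ck_on (Suc k) S f \<Longrightarrow> Ck_on k S f"
proof (induction k arbitrary: f)
  case 0
  then show ?case using Ck_on_imp_continuous_on[OF 0] by simp
next
  case (Suc k)
  then show ?case by (metis Ck_on.simps(2))
qed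

lemma Ck_on_local:
  assumes "\<And>x. x \<in> S \<Longrightarrow> \<exists>U. open U \<and> x \<in> U \<and> U \<subseteq> S \<and> Ck_on k U f"
  shows "Ck_on k S f"
  using assms
proof (induction k arbitrary: f)
  case 0
  then show ?case
    by (simp add: continuous_on_eq_continuous_within)
       (metis Ck_on.simps(1) at_within_interior continuous_on_eq_continuous_at interior_eq continuous_at_imp_continuous_at_within)
next
  case (Suc k)
  then show ?case by simp (meson subsetD)
qed

lemma Ck_on_const [intro, simp]: "open S \<Longrightarrow> Ck_on k S (\<lambda>x. c)"
  by (induction k arbitrary: c) auto

lemma Ck_on_bounded_linear:
  assumes "open S" "bounded_linear f" shows "Ck_on k S f"
proof (cases k)
  case (Suc j)
  show ?thesis unfolding Suc
    by (rule Ck_on_SucI[where f' = "\<lambda>_. f"])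
       (use assms bounded_linear_imp_has_derivative in auto)
qed (use assms linear_continuous_on in auto)

lemma Ck_on_add:
  assumes "open S" "Ck_on k S f" "Ck_on k S g" shows "Ck_on k S (\<lambda>x. f x + g x)"
  using assms(2,3)
proof (induction k arbitrary: f g)
  case (Suc k)
  show ?case
    by (rule Ck_on_SucI[OF assms(1) has_derivative_add[OF
          Ck_on_Suc_has_derivative[OF Suc.prems(1)] Ck_on_Suc_has_derivative[OF Suc.prems(2)]]])
       (use Suc in auto)
qed (simp add: continuous_on_add)

lemma Ck_on_sum:
  assumes "open S" "\<And>i. i \<in> I \<Longrightarrow> Ck_on k S (f i)" shows "Ck_on k S (\<lambda>x. \<Sum>i\<in>I. f i x)"
  using assms(2) by (induction I rule: infinite_finite_induct) (auto intro: Ck_on_add assms(1))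

lemma (in bounded_bilinear) Ck_on:
  assumes "open S" "Ck_on k S f" "Ck_on k S g" shows "Ck_on k S (\<lambda>x. prod (f x) (g x))"
  using assms(2,3)
proof (induction k arbitrary: f g)
  case 0
  then show ?case by (auto intro: continuous_on)
next
  case (Suc k)
  show ?case
    by (rule Ck_on_SucI[OF assms(1) FDERIV[OF
          Ck_on_Suc_has_derivative[OF Suc.prems(1)] Ck_on_Suc_has_derivative[OF Suc.prems(2)]]])
       (use Suc Ck_on_SucD[OF Suc.prems(1)] Ck_on_SucD[OF Suc.prems(2)] in
         \<open>auto intro!: Ck_on_add assms(1)\<close>)
qed

lemma (in bounded_linear) Ck_on:
  assumes "open S" "Ck_on k S g" shows "Ck_on k S (\<lambda>x. f (g x))"
  using assms(2)
proof (induction k arbitrary: g)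
  case 0
  then show ?case by (auto intro: continuous_on)
next
  case (Suc k)
  show ?case
    by (rule Ck_on_SucI[OF assms(1) has_derivative[OF Ck_on_Suc_has_derivative[OF Suc.prems]]])
       (use Suc in auto)
qed

lemma linear_basis_expansion:
  fixes L :: "'b::euclidean_space \<Rightarrow> 'c::real_vector"
  assumes "linear L" shows "L u = (\<Sum>b\<in>Basis. (u \<bullet> b) *\<^sub>R L b)"
  using linear_sum[OF assms, of "\<lambda>b. (u \<bullet> b) *\<^sub>R b" Basis] assms
  by (simp add: euclidean_representation linear_cmul)

text \<open>
  A family of linear maps that is \<open>C\<^sup>k\<close> on fixed vectors may be applied to a \<open>C\<^sup>k\<close> vector:
  expand the vector in the standard basis.  The chain rule, changes of coordinates and the
  evaluation of tensor fields on vector fields are all instances.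
\<close>

lemma Ck_on_linear_family:
  fixes L :: "'a::euclidean_space \<Rightarrow> 'b::euclidean_space \<Rightarrow> 'c::real_normed_vector"
  assumes "open S" "\<And>x. x \<in> S \<Longrightarrow> linear (L x)" "\<And>b. b \<in> Basis \<Longrightarrow> Ck_on k S (\<lambda>x. L x b)" "Ck_on k S u"
  shows "Ck_on k S (\<lambda>x. L x (u x))"
proof (rule Ck_on_cong[OF assms(1)])
  show "(\<Sum>b\<in>Basis. (u x \<bullet> b) *\<^sub>R L x b) = L x (u x)" if "x \<in> S" for x
    using linear_basis_expansion[OF assms(2)[OF that]] by metis
  show "Ck_on k S (\<lambda>x. \<Sum>b\<in>Basis. (u x \<bullet> b) *\<^sub>R L x b)"
    by (intro Ck_on_sum bounded_bilinear.Ck_on[OF bounded_bilinear_scaleR]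
        bounded_linear.Ck_on[OF bounded_linear_inner_left] assms)
qed

lemma has_derivative_linear_family:
  fixes L :: "'a::euclidean_space \<Rightarrow> 'b::euclidean_space \<Rightarrow> 'c::real_normed_vector"
  assumes "open S" "x \<in> S" "\<And>y. y \<in> S \<Longrightarrow> linear (L y)"
    and "\<And>b. b \<in> Basis \<Longrightarrow> (\<lambda>y. L y b) differentiable (at x)" "(u has_derivative u') (at x)"
  shows "((\<lambda>y. L y (u y)) has_derivative
      (\<lambda>v. frechet_derivative (\<lambda>y. L y (u x)) (at x) v + L x (u' v))) (at x)"
proof -
  let ?D = "\<lambda>b. frechet_derivative (\<lambda>y. L y b) (at x)"
  have D: "((\<lambda>y. L y b) has_derivative ?D b) (at x)" if "b \<in> Basis" for b
    using assms(4)[OF that] frechet_derivative_works by blast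
  have *: "((\<lambda>y. L y (w y)) has_derivative
      (\<lambda>v. (\<Sum>b\<in>Basis. (w x \<bullet> b) *\<^sub>R ?D b v + (w' v \<bullet> b) *\<^sub>R L x b))) (at x)"
    if w: "(w has_derivative w') (at x)" for w w'
  proof (rule has_derivative_transform_within_open[OF _ assms(1,2)])
    show "((\<lambda>y. \<Sum>b\<in>Basis. (w y \<bullet> b) *\<^sub>R L y b) has_derivative
      (\<lambda>v. (\<Sum>b\<in>Basis. (w x \<bullet> b) *\<^sub>R ?D b v + (w' v \<bullet> b) *\<^sub>R L x b))) (at x)"
      by (intro has_derivative_sum has_derivative_scaleR has_derivative_inner_left D w)
  qed (use linear_basis_expansion[OF assms(3)] in metis)
  have "frechet_derivative (\<lambda>y. L y (u x)) (at x) =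
      (\<lambda>v. (\<Sum>b\<in>Basis. (u x \<bullet> b) *\<^sub>R ?D b v + (0 \<bullet> b) *\<^sub>R L x b))"
    using frechet_derivative_at[OF *[OF has_derivative_const]] by metis
  moreover have "L x (u' v) = (\<Sum>b\<in>Basis. (u' v \<bullet> b) *\<^sub>R L x b)" for v
    using linear_basis_expansion[OF assms(3)[OF assms(2)]] by metis
  ultimately show ?thesis
    using *[OF assms(5)] by (simp add: sum.distrib)
qed

lemma has_derivative_bilinear_family:
  fixes B :: "'a::euclidean_space \<Rightarrow> 'b::euclidean_space \<Rightarrow> 'b \<Rightarrow> 'c::real_normed_vector"
  assumes S: "open S" "x \<in> S" and B: "\<And>y. y \<in> S \<Longrightarrow> bilinear (B y)"
    and d: "\<And>a b. (\<lambda>y. B y a b) differentiable (at x)"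
    and u: "(u has_derivative u') (at x)" and w: "(w has_derivative w') (at x)"
  shows "((\<lambda>y. B y (u y) (w y)) has_derivative
      (\<lambda>v. frechet_derivative (\<lambda>y. B y (u x) (w x)) (at x) v + B x (u' v) (w x) + B x (u x) (w' v))) (at x)"
proof -
  have lin: "linear (B y a)" "linear (\<lambda>a. B y a b)" if "y \<in> S" for y a b
    using B[OF that] by (auto simp: bilinear_def)
  have 1: "((\<lambda>y. B y a (w y)) has_derivative
      (\<lambda>v. frechet_derivative (\<lambda>y. B y a (w x)) (at x) v + B x a (w' v))) (at x)" for a
    by (rule has_derivative_linear_family[where L = "\<lambda>y. B y a", OF S lin(1) d w])
  have "((\<lambda>y. B y (u y) (w y)) has_derivative
      (\<lambda>v. frechet_derivative (\<lambda>y. B y (u x) (w y)) (at x) v + B x (u' v) (w x))) (at x)"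
    by (rule has_derivative_linear_family[where L = "\<lambda>y a. B y a (w y)", OF S lin(2) differentiableI[OF 1] u])
  moreover have "frechet_derivative (\<lambda>y. B y (u x) (w y)) (at x)
      = (\<lambda>v. frechet_derivative (\<lambda>y. B y (u x) (w x)) (at x) v + B x (u x) (w' v))"
    using frechet_derivative_at[OF 1] by metis
  ultimately show ?thesis by (simp add: add.assoc add.commute[of "B x (u x) _"])
qed

lemma Ck_on_compose:
  fixes f :: "'b::euclidean_space \<Rightarrow> 'c::real_normed_vector" and g :: "'a::euclidean_space \<Rightarrow> 'b"
  assumes "open S" "open U" "Ck_on k U f" "Ck_on k S g" "g ` S \<subseteq> U"
  shows "Ck_on k S (\<lambda>x. f (g x))"
  using assms(3,4)
proof (induction k arbitrary: f)
  case 0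
  then show ?case
    using continuous_on_compose2 assms(5) by (metis Ck_on.simps(1))
next
  case (Suc k)
  have gU: "g x \<in> U" if "x \<in> S" for x using that assms(5) by auto
  have D: "((\<lambda>x. f (g x)) has_derivative
      (\<lambda>v. frechet_derivative f (at (g x)) (frechet_derivative g (at x) v))) (at x)" if "x \<in> S" for x
    by (rule has_derivative_compose[OF Ck_on_Suc_has_derivative[OF Suc.prems(2) that]
        Ck_on_Suc_has_derivative[OF Suc.prems(1) gU[OF that]]])
  show ?case
  proof (rule Ck_on_SucI[OF assms(1) D])
    fix v
    show "Ck_on k S (\<lambda>x. frechet_derivative f (at (g x)) (frechet_derivative g (at x) v))"
    proof (rule Ck_on_linear_family[OF assms(1)])
      show "linear (frechet_derivative f (at (g x)))" if "x \<in> S" for x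
        using Suc.prems(1) gU[OF that] by (simp add: linear_frechet_derivative)
      show "Ck_on k S (\<lambda>x. frechet_derivative f (at (g x)) b)" if "b \<in> Basis" for b
        using Suc.IH[of "\<lambda>y. frechet_derivative f (at y) b"] Suc.prems Ck_on_SucD by auto
    qed (use Suc.prems in auto)
  qed auto
qed

lemma smooth_on_cong:
  assumes "open S" "\<And>x. x \<in> S \<Longrightarrow> f x = g x" "smooth_on S f" shows "smooth_on S g"
  using assms(3) Ck_on_cong[OF assms(1,2)] by (simp add: smooth_on_def)

lemma smooth_on_subset: "smooth_on S f \<Longrightarrow> U \<subseteq> S \<Longrightarrow> smooth_on U f"
  using Ck_on_subset[of _ S f U] by (simp add: smooth_on_def)

lemma smooth_on_local:
  assumes "\<And>x. x \<in> S \<Longrightarrow> \<exists>U. open U \<and> x \<in> U \<and> U \<subseteq> S \<and> smooth_on U f"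
  shows "smooth_on S f"
proof -
  have "Ck_on k S f" for k
  proof (rule Ck_on_local)
    show "\<exists>U. open U \<and> x \<in> U \<and> U \<subseteq> S \<and> Ck_on k U f" if "x \<in> S" for x
      using assms[OF that] unfolding smooth_on_def by metis
  qed
  then show ?thesis by (simp add: smooth_on_def)
qed

lemma smooth_on_const [simp]: "open S \<Longrightarrow> smooth_on S (\<lambda>x. c)"
  by (simp add: smooth_on_def)

lemma smooth_on_add: "open S \<Longrightarrow> smooth_on S f \<Longrightarrow> smooth_on S g \<Longrightarrow> smooth_on S (\<lambda>x. f x + g x)"
  by (simp add: smooth_on_def Ck_on_add)

lemma smooth_on_sum:
  "open S \<Longrightarrow> (\<And>i. i \<in> I \<Longrightarrow> smooth_on S (f i)) \<Longrightarrow> smooth_on S (\<lambda>x. \<Sum>i\<in>I. f i x)"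
  by (simp add: smooth_on_def Ck_on_sum)

lemma smooth_on_scaleR:
  "open S \<Longrightarrow> smooth_on S f \<Longrightarrow> smooth_on S g \<Longrightarrow> smooth_on S (\<lambda>x. f x *\<^sub>R g x)"
  by (simp add: smooth_on_def bounded_bilinear.Ck_on[OF bounded_bilinear_scaleR])

lemma smooth_on_mult:
  fixes f g :: "'a::euclidean_space \<Rightarrow> real"
  shows "open S \<Longrightarrow> smooth_on S f \<Longrightarrow> smooth_on S g \<Longrightarrow> smooth_on S (\<lambda>x. f x * g x)"
  using smooth_on_scaleR[of S f g] by simp

lemma smooth_on_diff: "open S \<Longrightarrow> smooth_on S f \<Longrightarrow> smooth_on S g \<Longrightarrow> smooth_on S (\<lambda>x. f x - g x)"
  using smooth_on_add[of S f "\<lambda>x. (-1) *\<^sub>R g x"] smooth_on_scaleR[of S "\<lambda>x. -1" g] by simp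

lemma smooth_on_inner_left: "open S \<Longrightarrow> smooth_on S f \<Longrightarrow> smooth_on S (\<lambda>x. f x \<bullet> b)"
  by (simp add: smooth_on_def bounded_linear.Ck_on[OF bounded_linear_inner_left])

lemma smooth_on_compose:
  fixes f :: "'b::euclidean_space \<Rightarrow> 'c::real_normed_vector" and g :: "'a::euclidean_space \<Rightarrow> 'b"
  assumes "open S" "open U" "smooth_on U f" "smooth_on S g" "g ` S \<subseteq> U"
  shows "smooth_on S (\<lambda>x. f (g x))"
proof -
  have "Ck_on k S (\<lambda>x. f (g x))" for k
    by (rule Ck_on_compose[OF assms(1,2) _ _ assms(5)]) (use assms(3,4) in \<open>simp_all add: smooth_on_def\<close>)
  then show ?thesis by (simp add: smooth_on_def)
qed

lemma smooth_on_linear_family: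
  fixes L :: "'a::euclidean_space \<Rightarrow> 'b::euclidean_space \<Rightarrow> 'c::real_normed_vector"
  assumes "open S" "\<And>x. x \<in> S \<Longrightarrow> linear (L x)" "\<And>b. smooth_on S (\<lambda>x. L x b)" "smooth_on S u"
  shows "smooth_on S (\<lambda>x. L x (u x))"
  using Ck_on_linear_family[OF assms(1,2), where u = u] assms(3,4) by (simp add: smooth_on_def)

lemma smooth_on_bilinear_family:
  fixes B :: "'a::euclidean_space \<Rightarrow> 'b::euclidean_space \<Rightarrow> 'b \<Rightarrow> 'c::real_normed_vector"
  assumes S: "open S" and B: "\<And>x. x \<in> S \<Longrightarrow> bilinear (B x)" "\<And>a b. smooth_on S (\<lambda>x. B x a b)"
    and u: "smooth_on S u" and w: "smooth_on S w"
  shows "smooth_on S (\<lambda>x. B x (u x) (w x))"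
proof (rule smooth_on_linear_family[OF S _ _ u])
  show "smooth_on S (\<lambda>x. B x a (w x))" for a
    by (rule smooth_on_linear_family[OF S _ _ w]) (use B in \<open>auto simp: bilinear_def\<close>)
qed (use B(1) in \<open>auto simp: bilinear_def\<close>)

lemma smooth_on_has_derivative:
  "smooth_on S f \<Longrightarrow> x \<in> S \<Longrightarrow> (f has_derivative frechet_derivative f (at x)) (at x)"
  using Ck_on_Suc_has_derivative[of 0 S f x] unfolding smooth_on_def by blast

lemma smooth_on_differentiable: "smooth_on S f \<Longrightarrow> x \<in> S \<Longrightarrow> f differentiable (at x)"
  using smooth_on_has_derivative differentiable_def by blast

lemma smooth_on_linear_derivative: "smooth_on S f \<Longrightarrow> x \<in> S \<Longrightarrow> linear (frechet_derivative f (at x))"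
  by (simp add: linear_frechet_derivative smooth_on_differentiable)

lemma smooth_on_derivative: "smooth_on S f \<Longrightarrow> smooth_on S (\<lambda>x. frechet_derivative f (at x) v)"
  unfolding smooth_on_def by (metis Ck_on.simps(2))

lemma smooth_on_continuous_on: "smooth_on S f \<Longrightarrow> continuous_on S f"
  unfolding smooth_on_def by (metis Ck_on.simps(1))

lemma smooth_on_ident: "open S \<Longrightarrow> smooth_on S (\<lambda>x. x)"
  by (simp add: smooth_on_def Ck_on_bounded_linear bounded_linear_ident)

lemma linear_derivative_of_family:
  assumes "open S" "x \<in> S" "\<And>y. y \<in> S \<Longrightarrow> linear (H y)" "\<And>u. (\<lambda>y. H y u) differentiable (at x)"
  shows "linear (\<lambda>u. frechet_derivative (\<lambda>y. H y u) (at x) v)"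
proof -
  let ?D = "\<lambda>u. frechet_derivative (\<lambda>y. H y u) (at x)"
  have D: "((\<lambda>y. H y u) has_derivative ?D u) (at x)" for u
    using assms(4) frechet_derivative_works by blast
  have "((\<lambda>y. H y (u + w)) has_derivative (\<lambda>v. ?D u v + ?D w v)) (at x)" for u w
    by (rule has_derivative_transform_within_open[OF has_derivative_add[OF D D] assms(1,2)])
       (simp add: assms(3) linear_add)
  moreover have "((\<lambda>y. H y (c *\<^sub>R u)) has_derivative (\<lambda>v. c *\<^sub>R ?D u v)) (at x)" for u c
    by (rule has_derivative_transform_within_open[OF has_derivative_scaleR_right[OF D] assms(1,2)])
       (simp add: assms(3) linear_cmul)
  ultimately show ?thesis
    by (intro linearI; metis (no_types, lifting) frechet_derivative_at)
qed

subsection \<open>Linear systems with smooth coefficients\<close>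

text \<open>
  A product rule in which one factor is merely continuous, at a point where both factors vanish.
  It yields differentiability of a solution of a linear system from its continuity.
\<close>

lemma has_derivative_zero_scaleR:
  fixes a :: "'a::real_normed_vector \<Rightarrow> real"
  assumes "a \<midarrow>x\<rightarrow> 0" "(c has_derivative c') (at x)" "c x = 0"
  shows "((\<lambda>y. a y *\<^sub>R c y) has_derivative (\<lambda>v. 0)) (at x)"
proof -
  define q where "q h = norm (c (x + h) - c x - c' h) / norm h" for h
  have q: "q \<midarrow>0\<rightarrow> 0"
    using assms(2) unfolding has_derivative_at q_def by simp
  obtain K where K: "norm (c' h) \<le> norm h * K" for h
    using bounded_linear.bounded[OF has_derivative_bounded_linear[OF assms(2)]] by blast
  have a0: "(\<lambda>h. a (x + h)) \<midarrow>0\<rightarrow> 0"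
    using assms(1) LIM_offset_zero by fastforce
  have "(\<lambda>h. \<bar>a (x + h)\<bar> * (q h + K)) \<midarrow>0\<rightarrow> \<bar>0\<bar> * (0 + K)"
    by (intro tendsto_intros q a0)
  then have lim: "(\<lambda>h. \<bar>a (x + h)\<bar> * (q h + K)) \<midarrow>0\<rightarrow> 0"
    by simp
  have bound: "\<bar>a (x + h)\<bar> * norm (c (x + h)) / norm h \<le> \<bar>a (x + h)\<bar> * (q h + K)" if "h \<noteq> 0" for h
  proof -
    have "norm (c (x + h)) \<le> norm (c (x + h) - c x - c' h) + norm (c' h)"
      using norm_triangle_sub[of "c (x + h)" "c' h"] assms(3) by simp
    also have "\<dots> \<le> norm h * (q h + K)"
      using K[of h] that by (simp add: q_def algebra_simps)
    finally have "norm (c (x + h)) / norm h \<le> q h + K"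
      using that by (simp add: divide_simps mult.commute)
    from mult_left_mono[OF this, of "\<bar>a (x + h)\<bar>"] show ?thesis by simp
  qed
  have "(\<lambda>h. norm (a (x + h) *\<^sub>R c (x + h)) / norm h) \<midarrow>0\<rightarrow> 0"
    by (rule tendsto_sandwich[OF _ _ tendsto_const lim])
       (auto simp: eventually_at_filter bound intro!: always_eventually)
  then show ?thesis
    unfolding has_derivative_at using assms(3) by simp
qed

text \<open>
  Instead of inverting the coefficient matrix, the solution \<open>V\<close> is treated directly.  Continuity
  at \<open>x\<close> follows from a lower bound for the injective map \<open>H(x)\<close>, which persists nearby.  Writing
  \<open>V - V(x)\<close> through a left inverse of \<open>H(x)\<close> shows differentiability at \<open>x\<close>, and differentiating
  \<open>H V = K\<close> shows that each directional derivative of \<open>V\<close> solves a system with the same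
  coefficients \<open>H\<close>; hence the induction on the order \<open>k\<close>.
\<close>

lemma Ck_on_linear_system_solution:
  fixes H :: "'a::euclidean_space \<Rightarrow> 'b::euclidean_space \<Rightarrow> 'c::euclidean_space"
  assumes S: "open S" and lin: "\<And>x. x \<in> S \<Longrightarrow> linear (H x)" and inj: "\<And>x. x \<in> S \<Longrightarrow> inj (H x)"
    and H: "\<And>b. smooth_on S (\<lambda>x. H x b)" and K: "Ck_on k S K" and V: "\<And>x. x \<in> S \<Longrightarrow> H x (V x) = K x"
  shows "Ck_on k S V"
  using K V
proof (induction k arbitrary: K V)
  case 0
  have "V \<midarrow>x\<rightarrow> V x" if x: "x \<in> S" for x
  proof -
    obtain B where B: "B > 0" "B * norm w \<le> norm (H x w)" for w
      using linear_inj_bounded_below_pos[OF lin[OF x] inj[OF x]] by blast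
    define e where "e y = (\<Sum>b\<in>Basis. norm (H y b - H x b))" for y
    define n where "n y = norm (K y - H y (V x))" for y
    have cont: "isCont (\<lambda>y. H y w) x" for w
      using smooth_on_continuous_on[OF H] S x continuous_on_eq_continuous_at by blast
    have "isCont K x"
      using 0 S x continuous_on_eq_continuous_at by auto
    then have "n \<midarrow>x\<rightarrow> norm (K x - H x (V x))"
      using cont[of "V x"] unfolding n_def isCont_def by (intro tendsto_norm tendsto_diff)
    then have n: "n \<midarrow>x\<rightarrow> 0"
      using 0(2)[OF x] by simp
    have "e \<midarrow>x\<rightarrow> (\<Sum>b\<in>Basis. norm (H x b - H x b))"
      unfolding e_def using cont unfolding isCont_def by (intro tendsto_intros)
    then have e: "e \<midarrow>x\<rightarrow> 0" by simp
    have bound: "norm (V y - V x) \<le> 2 / B * n y" if y: "y \<in> S" "e y < B / 2" for y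
    proof -
      define w where "w = V y - V x"
      have "H y w - H x w = (\<Sum>b\<in>Basis. (w \<bullet> b) *\<^sub>R (H y b - H x b))"
        using linear_basis_expansion[OF lin[OF x], of w] linear_basis_expansion[OF lin[OF y(1)], of w]
        by (simp add: sum_subtractf scaleR_diff_right)
      also have "norm \<dots> \<le> (\<Sum>b\<in>Basis. norm w * norm (H y b - H x b))"
        by (rule sum_norm_le) (auto intro!: mult_right_mono simp: Basis_le_norm)
      also have "\<dots> = e y * norm w" by (simp add: e_def sum_distrib_left mult.commute)
      finally have "norm (H y w - H x w) \<le> e y * norm w" .
      moreover have "e y * norm w \<le> B / 2 * norm w"
        by (intro mult_right_mono) (use y in auto)
      moreover have "norm (H x w) \<le> norm (H y w - H x w) + norm (H y w)"
        using norm_triangle_ineq4[of "H y w" "H y w - H x w"] by (simp add: norm_minus_commute)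
      moreover have "norm (H y w) = n y"
        using 0(2)[OF y(1)] lin[OF y(1)] by (simp add: n_def w_def linear_diff)
      ultimately have "B / 2 * norm w \<le> n y"
        using B(2)[of w] by (simp add: algebra_simps)
      then show ?thesis using B(1) by (simp add: w_def field_simps)
    qed
    have "\<forall>\<^sub>F y in at x. y \<in> S"
      using S x by (simp add: eventually_at_topological) blast
    moreover have "\<forall>\<^sub>F y in at x. e y < B / 2"
      by (rule order_tendstoD(2)[OF e half_gt_zero[OF B(1)]])
    ultimately have "\<forall>\<^sub>F y in at x. norm (V y - V x) \<le> 2 / B * n y"
      by eventually_elim (rule bound)
    then have "(\<lambda>y. V y - V x) \<midarrow>x\<rightarrow> 0"
      by (rule Lim_null_comparison) (rule tendsto_mult_right_zero[OF n])
    then show ?thesis by (simp add: LIM_zero_iff)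
  qed
  then show ?case
    using S by (simp add: continuous_on_eq_continuous_at isCont_def)
next
  case (Suc k)
  have VC: "Ck_on k S V"
    by (rule Suc.IH[OF Ck_on_SucD[OF Suc.prems(1)] Suc.prems(2)])
  have DK: "(K has_derivative frechet_derivative K (at x)) (at x)" if "x \<in> S" for x
    using Ck_on_Suc_has_derivative[OF Suc.prems(1) that] .
  have DH: "(\<lambda>y. H y w) differentiable (at x)" if "x \<in> S" for x w
    using smooth_on_differentiable[OF H that] .
  have DV: "V differentiable (at x)" if x: "x \<in> S" for x
  proof -
    obtain G where G: "linear G" "\<And>w. G (H x w) = w"
      using linear_injective_left_inverse[OF lin[OF x] inj[OF x]] by (auto simp: fun_eq_iff)
    define m where "m y = K y - H y (V x)" for y
    have "m differentiable (at x)"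
      unfolding m_def using DK[OF x] by (intro differentiable_diff DH[OF x]) (rule differentiableI)
    then have 1: "(\<lambda>y. G (m y)) differentiable (at x)"
      unfolding differentiable_def
      using bounded_linear.has_derivative[OF G(1)[unfolded linear_conv_bounded_linear]] by blast
    have cont: "V \<midarrow>x\<rightarrow> V x"
      using Ck_on_imp_continuous_on[OF VC] S x by (simp add: continuous_on_eq_continuous_at isCont_def)
    have "((\<lambda>y. ((V y - V x) \<bullet> b) *\<^sub>R G (H y b - H x b)) has_derivative (\<lambda>v. 0)) (at x)" for b
    proof (rule has_derivative_zero_scaleR)
      show "(\<lambda>y. (V y - V x) \<bullet> b) \<midarrow>x\<rightarrow> 0"
        using tendsto_inner[OF LIM_zero[OF cont] tendsto_const[of b]] by simp
      show "((\<lambda>y. G (H y b - H x b)) has_derivative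
         (\<lambda>v. G (frechet_derivative (\<lambda>y. H y b) (at x) v - 0))) (at x)"
        by (rule bounded_linear.has_derivative[OF G(1)[unfolded linear_conv_bounded_linear]
              has_derivative_diff[OF DH[OF x, unfolded frechet_derivative_works] has_derivative_const]])
      show "G (H x b - H x b) = 0" using G(1) by (simp add: linear_0)
    qed
    then have 2: "(\<lambda>y. \<Sum>b\<in>Basis. ((V y - V x) \<bullet> b) *\<^sub>R G (H y b - H x b)) differentiable (at x)"
      by (intro differentiable_sum) (auto simp: differentiable_def)
    have "V x + G (m y) - (\<Sum>b\<in>Basis. ((V y - V x) \<bullet> b) *\<^sub>R G (H y b - H x b)) = V y"
      if y: "y \<in> S" for y
    proof -
      have "linear (\<lambda>w. G (H y w - H x w))"
        using G(1) lin[OF y] lin[OF x]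
        by (auto intro!: linearI simp: linear_diff linear_add linear_cmul scaleR_diff_right)
      note eq = linear_basis_expansion[OF this, of "V y - V x"]
      show ?thesis
        unfolding eq[symmetric] using Suc.prems(2)[OF y] lin[OF y] lin[OF x] G
        by (simp add: m_def linear_diff)
    qed
    moreover have "(\<lambda>y. V x + G (m y) - (\<Sum>b\<in>Basis. ((V y - V x) \<bullet> b) *\<^sub>R G (H y b - H x b)))
        differentiable (at x)"
      by (intro differentiable_diff differentiable_add differentiable_const 1 2)
    ultimately show ?thesis
      unfolding differentiable_def by (auto intro: has_derivative_transform_within_open[OF _ S x])
  qed
  have DV': "(V has_derivative frechet_derivative V (at x)) (at x)" if "x \<in> S" for x
    using DV[OF that] frechet_derivative_works by blast
  let ?DH = "\<lambda>v x w. frechet_derivative (\<lambda>y. H y w) (at x) v"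
  show ?case
  proof (rule Ck_on_SucI[OF S DV'])
    fix v
    show "Ck_on k S (\<lambda>x. frechet_derivative V (at x) v)"
    proof (rule Suc.IH[of "\<lambda>x. frechet_derivative K (at x) v + (-1) *\<^sub>R ?DH v x (V x)"])
      show "Ck_on k S (\<lambda>x. frechet_derivative K (at x) v + (-1) *\<^sub>R ?DH v x (V x))"
      proof (intro Ck_on_add bounded_linear.Ck_on[OF bounded_linear_scaleR_right] S)
        show "Ck_on k S (\<lambda>x. frechet_derivative K (at x) v)"
          using Suc.prems(1) by simp
        show "Ck_on k S (\<lambda>x. ?DH v x (V x))"
        proof (rule Ck_on_linear_family[OF S _ _ VC])
          show "linear (?DH v x)" if "x \<in> S" for x
            by (rule linear_derivative_of_family[OF S that lin DH[OF that]])
          show "Ck_on k S (\<lambda>x. ?DH v x b)" for b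
            using smooth_on_derivative[OF H] by (simp add: smooth_on_def)
        qed
      qed
      show "H x (frechet_derivative V (at x) v) = frechet_derivative K (at x) v + (-1) *\<^sub>R ?DH v x (V x)"
        if x: "x \<in> S" for x
      proof -
        have "((\<lambda>y. H y (V y)) has_derivative
            (\<lambda>v. ?DH v x (V x) + H x (frechet_derivative V (at x) v))) (at x)"
          by (rule has_derivative_linear_family[OF S x lin DH[OF x] DV'[OF x]])
        then have "(K has_derivative (\<lambda>v. ?DH v x (V x) + H x (frechet_derivative V (at x) v))) (at x)"
          by (rule has_derivative_transform_within_open[OF _ S x]) (rule Suc.prems(2))
        then have "frechet_derivative K (at x) = (\<lambda>v. ?DH v x (V x) + H x (frechet_derivative V (at x) v))"
          using frechet_derivative_at by metis
        then show ?thesis by simp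
      qed
    qed
  qed auto
qed

lemma nondegenerate_bilinear_represents:
  fixes B :: "'a::euclidean_space \<Rightarrow> 'a \<Rightarrow> real"
  assumes B: "bilinear B" and nd: "\<And>v. (\<And>w. B v w = 0) \<Longrightarrow> v = 0" and f: "linear f"
  shows "\<exists>v. \<forall>w. B v w = f w"
proof -
  define \<phi> where "\<phi> v = (\<Sum>b\<in>Basis. B v b *\<^sub>R b)" for v
  have B1: "linear (B v)" and B2: "linear (\<lambda>v. B v w)" for v w
    using B by (auto simp: bilinear_def)
  have expand: "g w = (\<Sum>b\<in>Basis. (w \<bullet> b) * g b)" if "linear g" for g :: "'a \<Rightarrow> real" and w
    using linear_basis_expansion[OF that, of w] by (simp only: real_scaleR_def)
  have "linear \<phi>"
    unfolding \<phi>_def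
    by (intro linearI) (simp_all add: linear_add[OF B2] linear_cmul[OF B2] scaleR_add_left sum.distrib
        scaleR_sum_right)
  moreover have "inj \<phi>"
    unfolding linear_injective_0[OF \<open>linear \<phi>\<close>]
  proof (intro allI impI nd)
    fix v w assume "\<phi> v = 0"
    then have "B v b = 0" if "b \<in> Basis" for b
      using that inner_sum_left_Basis[of b "B v"] by (simp add: \<phi>_def)
    then show "B v w = 0" using expand[OF B1, of v w] by simp
  qed
  ultimately have "surj \<phi>" by (rule linear_inj_imp_surj)
  then obtain v where v: "\<phi> v = (\<Sum>b\<in>Basis. f b *\<^sub>R b)" by (metis surjD)
  have "B v b = f b" if "b \<in> Basis" for b
  proof -
    have "B v b = \<phi> v \<bullet> b" using that by (simp add: \<phi>_def inner_sum_left_Basis)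
    also have "\<dots> = f b" unfolding v using that by (simp add: inner_sum_left_Basis)
    finally show ?thesis .
  qed
  then have "B v w = f w" for w
    using expand[OF B1, of v w] expand[OF f, of w] by simp
  then show ?thesis by blast
qed

subsection \<open>Symmetry of second derivatives\<close>

text \<open>
  Schwarz's theorem: two applications of the mean value theorem turn the second difference, which
  is symmetric in \<open>v\<close> and \<open>w\<close>, into a mixed second derivative at a nearby point.  Exchanging the
  roles of \<open>v\<close> and \<open>w\<close> and shrinking the parallelogram gives the symmetry.
\<close>

lemma second_difference_mean_value:
  fixes f :: "'a::euclidean_space \<Rightarrow> real"
  assumes sm: "smooth_on (ball x e) f" and "0 < t" and t: "t * (norm v + norm w) < e"
  obtains p where "dist x p \<le> t * (norm v + norm w)"
    "f (x + t *\<^sub>R v + t *\<^sub>R w) - f (x + t *\<^sub>R v) - f (x + t *\<^sub>R w) + f x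
      = t * t * frechet_derivative (\<lambda>y. frechet_derivative f (at y) v) (at p) w"
proof -
  let ?p = "\<lambda>a b. x + a *\<^sub>R v + b *\<^sub>R w"
  have le: "dist x (?p a b) \<le> t * (norm v + norm w)" if "0 \<le> a" "a \<le> t" "0 \<le> b" "b \<le> t" for a b
  proof -
    have "dist x (?p a b) \<le> norm (a *\<^sub>R v) + norm (b *\<^sub>R w)"
      by (metis add.assoc add_diff_cancel_left' dist_commute dist_norm norm_triangle_ineq)
    also have "\<dots> \<le> t * norm v + t * norm w"
      using that by (intro add_mono) (auto intro!: mult_right_mono)
    finally show ?thesis by (simp add: algebra_simps)
  qed
  have in_ball: "?p a b \<in> ball x e" if "0 \<le> a" "a \<le> t" "0 \<le> b" "b \<le> t" for a b
    using le[OF that] t by simp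
  let ?v = "\<lambda>y. frechet_derivative f (at y) v"
  have D1: "((\<lambda>a. f (?p a b)) has_real_derivative ?v (?p a b)) (at a)"
    if "0 \<le> a" "a \<le> t" "0 \<le> b" "b \<le> t" for a b
  proof -
    have "((\<lambda>a. f (?p a b)) has_derivative (\<lambda>s. frechet_derivative f (at (?p a b)) (s *\<^sub>R v))) (at a)"
      by (rule has_derivative_compose[where g = f and f = "\<lambda>a. ?p a b",
            OF _ smooth_on_has_derivative[OF sm in_ball[OF that]]])
         (auto intro!: derivative_eq_intros)
    then show ?thesis
      using smooth_on_linear_derivative[OF sm in_ball[OF that]]
      by (simp add: has_field_derivative_def linear_cmul mult.commute[of _ "?v _"]; simp add: mult.commute)
  qed
  have D2: "((\<lambda>b. ?v (?p a b)) has_real_derivative frechet_derivative ?v (at (?p a b)) w) (at b)"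
    if "0 \<le> a" "a \<le> t" "0 \<le> b" "b \<le> t" for a b
  proof -
    note sm' = smooth_on_derivative[OF sm, of v]
    have "((\<lambda>b. ?v (?p a b)) has_derivative (\<lambda>s. frechet_derivative ?v (at (?p a b)) (s *\<^sub>R w))) (at b)"
      by (rule has_derivative_compose[where g = ?v and f = "\<lambda>b. ?p a b",
            OF _ smooth_on_has_derivative[OF sm' in_ball[OF that]]])
         (auto intro!: derivative_eq_intros)
    then show ?thesis
      using smooth_on_linear_derivative[OF sm' in_ball[OF that]]
      by (simp add: has_field_derivative_def linear_cmul mult.commute[of _ "frechet_derivative ?v _ _"]; simp add: mult.commute)
  qed
  have "((\<lambda>a. f (?p a t) - f (?p a 0)) has_real_derivative ?v (?p a t) - ?v (?p a 0)) (at a)"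
    if "0 \<le> a" "a \<le> t" for a
    by (rule DERIV_diff[OF D1 D1]) (use that \<open>0 < t\<close> in auto)
  from MVT2[OF \<open>0 < t\<close> this] obtain a where a: "0 < a" "a < t"
    "(f (?p t t) - f (?p t 0)) - (f (?p 0 t) - f (?p 0 0)) = (t - 0) * (?v (?p a t) - ?v (?p a 0))"
    by blast
  have "((\<lambda>b. ?v (?p a b)) has_real_derivative frechet_derivative ?v (at (?p a b)) w) (at b)"
    if "0 \<le> b" "b \<le> t" for b
    by (rule D2) (use that a in auto)
  from MVT2[OF \<open>0 < t\<close> this] obtain b where b: "0 < b" "b < t"
    "?v (?p a t) - ?v (?p a 0) = (t - 0) * frechet_derivative ?v (at (?p a b)) w"
    by blast
  show ?thesis
    by (rule that[of "?p a b"]) (use a b le[of a b] in \<open>auto simp: algebra_simps\<close>)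
qed

lemma second_derivative_symmetric_real:
  fixes f :: "'a::euclidean_space \<Rightarrow> real"
  assumes "open S" "x \<in> S" "smooth_on S f"
  shows "frechet_derivative (\<lambda>y. frechet_derivative f (at y) v) (at x) w
    = frechet_derivative (\<lambda>y. frechet_derivative f (at y) w) (at x) v"
proof (rule ccontr)
  define F where "F v w p = frechet_derivative (\<lambda>y. frechet_derivative f (at y) v) (at p) w" for v w p
  assume "\<not> ?thesis"
  then have pos: "dist (F v w x) (F w v x) / 2 > 0" (is "?r > 0") by (simp add: F_def)
  obtain e where e: "e > 0" "ball x e \<subseteq> S"
    using assms(1,2) openE by blast
  have "isCont (F a b) x" for a b
    using smooth_on_continuous_on[OF smooth_on_derivative[OF smooth_on_derivative[OF assms(3)]]] assms(1,2)
    unfolding F_def using continuous_on_eq_continuous_at by blast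
  then have "\<exists>d>0. \<forall>p. dist p x < d \<longrightarrow> dist (F a b p) (F a b x) < ?r" for a b
    using pos unfolding continuous_at_eps_delta by blast
  then obtain d d' where d: "d > 0" "\<And>p. dist p x < d \<Longrightarrow> dist (F v w p) (F v w x) < ?r"
    and d': "d' > 0" "\<And>p. dist p x < d' \<Longrightarrow> dist (F w v p) (F w v x) < ?r" by metis
  \<comment> \<open>the parallelogram with sides \<open>t v\<close> and \<open>t w\<close> has to stay in the ball of radius \<open>m\<close>\<close>
  define m where "m = min e (min d d')"
  define t where "t = m / (norm v + norm w + 1) / 2"
  have m: "m > 0" using e d d' by (simp add: m_def)
  have N: "norm v + norm w + 1 > 0" by (simp add: add_nonneg_pos)
  have t: "t > 0" using m N unfolding t_def by (intro divide_pos_pos) auto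
  have "t * (norm v + norm w + 1) = m / 2"
    using N unfolding t_def by (metis less_numeral_extra(3) nonzero_eq_divide_eq times_divide_eq_left)
  then have tm: "t * (norm v + norm w) < m"
    using t m by (simp add: algebra_simps)
  have sm: "smooth_on (ball x e) f"
    using assms(3) e(2) smooth_on_subset by blast
  obtain p where p: "dist x p \<le> t * (norm v + norm w)"
    "f (x + t *\<^sub>R v + t *\<^sub>R w) - f (x + t *\<^sub>R v) - f (x + t *\<^sub>R w) + f x = t * t * F v w p"
    using second_difference_mean_value[OF sm t, of v w] tm unfolding F_def m_def by auto
  obtain q where q: "dist x q \<le> t * (norm w + norm v)"
    "f (x + t *\<^sub>R w + t *\<^sub>R v) - f (x + t *\<^sub>R w) - f (x + t *\<^sub>R v) + f x = t * t * F w v q"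
    using second_difference_mean_value[OF sm t, of w v] tm unfolding F_def m_def by (auto simp: add.commute)
  have "t * t * F v w p = t * t * F w v q"
    using p(2) q(2) by (simp add: algebra_simps)
  then have "F v w p = F w v q" using t by simp
  moreover have "dist (F v w p) (F v w x) < ?r"
    using p(1) tm by (intro d) (simp add: m_def dist_commute)
  moreover have "dist (F w v q) (F w v x) < ?r"
    using q(1) tm by (intro d') (simp add: m_def dist_commute add.commute)
  ultimately show False
    by (smt (verit) dist_commute dist_triangle2 field_sum_of_halves)
qed

lemma second_derivative_symmetric:
  fixes f :: "'a::euclidean_space \<Rightarrow> 'b::euclidean_space"
  assumes "open S" "x \<in> S" "smooth_on S f"
  shows "frechet_derivative (\<lambda>y. frechet_derivative f (at y) v) (at x) w
    = frechet_derivative (\<lambda>y. frechet_derivative f (at y) w) (at x) v"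
proof (rule euclidean_eqI)
  fix b :: 'b
  have D: "frechet_derivative (\<lambda>y. h y \<bullet> b) (at z) u = frechet_derivative h (at z) u \<bullet> b"
    if "smooth_on S h" "z \<in> S" for h :: "'a \<Rightarrow> 'b" and z u
    using frechet_derivative_at[OF bounded_linear.has_derivative[OF bounded_linear_inner_left
          smooth_on_has_derivative[OF that]]] by metis
  have *: "frechet_derivative (\<lambda>y. frechet_derivative f (at y) v) (at x) w \<bullet> b
    = frechet_derivative (\<lambda>y. frechet_derivative (\<lambda>z. f z \<bullet> b) (at y) v) (at x) w" for v w
  proof -
    have "((\<lambda>y. frechet_derivative (\<lambda>z. f z \<bullet> b) (at y) v) has_derivative
        (\<lambda>w. frechet_derivative (\<lambda>y. frechet_derivative f (at y) v) (at x) w \<bullet> b)) (at x)"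
      by (rule has_derivative_transform_within_open[OF bounded_linear.has_derivative[OF
              bounded_linear_inner_left smooth_on_has_derivative[OF smooth_on_derivative[OF assms(3)]
                assms(2)]] assms(1,2)]) (simp add: D assms(3))
    then show ?thesis using frechet_derivative_at by metis
  qed
  show "frechet_derivative (\<lambda>y. frechet_derivative f (at y) v) (at x) w \<bullet> b
    = frechet_derivative (\<lambda>y. frechet_derivative f (at y) w) (at x) v \<bullet> b"
    unfolding * by (rule second_derivative_symmetric_real[OF assms(1,2) smooth_on_inner_left[OF assms(1,3)]])
qed

subsection \<open>Bump functions\<close>

text \<open>
  The functions \<open>exp (- 1 / t) / t\<^sup>n\<close> extended by zero are considered for all \<open>n\<close> at once because
  the derivative of each is a linear combination of others in the family.
\<close>

definition flat_exp :: "nat \<Rightarrow> real \<Rightarrow> real" where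
  "flat_exp n t = (if t > 0 then exp (- 1 / t) / t ^ n else 0)"

lemma flat_exp_derivative:
  "(flat_exp n has_real_derivative flat_exp (n + 2) t - n * flat_exp (n + 1) t) (at t)"
proof -
  consider "t < 0" | "t > 0" | "t = 0" by linarith
  then show ?thesis
  proof cases
    case 1
    have "(flat_exp n has_real_derivative 0) (at t)"
      by (rule has_field_derivative_transform_within_open[where S = "{..<0}", OF DERIV_const[of 0]])
         (use 1 in \<open>auto simp: flat_exp_def\<close>)
    then show ?thesis using 1 by (simp add: flat_exp_def)
  next
    case 2
    have E: "((\<lambda>t. exp (- 1 / t)) has_real_derivative exp (- 1 / t) / t ^ 2) (at t)"
      using 2 by (auto intro!: derivative_eq_intros simp: power2_eq_square)
    have "((\<lambda>t. exp (- 1 / t) / t ^ n) has_real_derivative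
        exp (- 1 / t) / t ^ (n + 2) - n * (exp (- 1 / t) / t ^ (n + 1))) (at t)"
    proof (rule DERIV_cong[OF DERIV_divide[OF E DERIV_pow]])
      show "t ^ n \<noteq> 0" using 2 by simp
      have "real n * t ^ (n - Suc 0) * t = real n * t ^ n" by (cases n) auto
      then have "real n * t ^ (n - Suc 0) = real n * t ^ n / t"
        using 2 by (simp add: nonzero_eq_divide_eq)
      then show "(exp (- 1 / t) / t\<^sup>2 * t ^ n - exp (- 1 / t) * (real n * t ^ (n - Suc 0))) / (t ^ n * t ^ n)
          = exp (- 1 / t) / t ^ (n + 2) - n * (exp (- 1 / t) / t ^ (n + 1))"
        using 2 by (auto simp: field_simps power2_eq_square)
    qed
    then have "(flat_exp n has_real_derivative
        exp (- 1 / t) / t ^ (n + 2) - n * (exp (- 1 / t) / t ^ (n + 1))) (at t)"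
      by (rule has_field_derivative_transform_within_open[where S = "{0<..}"])
         (use 2 in \<open>auto simp: flat_exp_def\<close>)
    then show ?thesis using 2 by (simp add: flat_exp_def)
  next
    case 3
    have "((\<lambda>t. inverse t ^ (n + 1) / exp (inverse t)) \<longlongrightarrow> (0::real)) (at_right 0)"
      by (rule filterlim_compose[OF tendsto_power_div_exp_0 filterlim_inverse_at_top_right])
    then have "((\<lambda>h. flat_exp n h / h) \<longlongrightarrow> 0) (at_right 0)"
      by (rule Lim_transform_eventually)
         (auto simp: flat_exp_def eventually_at_filter exp_minus field_simps)
    moreover have "((\<lambda>h. flat_exp n h / h) \<longlongrightarrow> 0) (at_left 0)"
      by (rule Lim_transform_eventually[OF tendsto_const])
         (auto simp: flat_exp_def eventually_at_filter)
    ultimately have "((\<lambda>h. flat_exp n h / h) \<longlongrightarrow> 0) (at 0)"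
      by (simp add: filterlim_at_split)
    then show ?thesis using 3 by (simp add: flat_exp_def DERIV_def)
  qed
qed

lemma smooth_on_flat_exp: "smooth_on UNIV (flat_exp n)"
proof -
  have "Ck_on k UNIV (flat_exp n)" for k
  proof (induction k arbitrary: n)
    case 0
    then show ?case
      using DERIV_isCont[OF flat_exp_derivative] by (simp add: continuous_on_eq_continuous_at)
  next
    case (Suc k)
    show ?case
    proof (rule Ck_on_SucI[OF open_UNIV])
      show "(flat_exp n has_derivative (*) (flat_exp (n + 2) t - n * flat_exp (n + 1) t)) (at t)" for t
        using flat_exp_derivative[of n t] by (simp add: has_field_derivative_def)
      show "Ck_on k UNIV (\<lambda>t. (flat_exp (n + 2) t - n * flat_exp (n + 1) t) * v)" for v
        using Ck_on_add[OF open_UNIV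
            bounded_linear.Ck_on[OF bounded_linear_mult_right[of v] open_UNIV Suc.IH[of "n + 2"]]
            bounded_linear.Ck_on[OF bounded_linear_mult_right[of "- real n * v"] open_UNIV Suc.IH[of "n + 1"]]]
        by (simp add: algebra_simps)
    qed
  qed
  then show ?thesis by (simp add: smooth_on_def)
qed

definition bump :: "'a::euclidean_space \<Rightarrow> real \<Rightarrow> 'a \<Rightarrow> real" where
  "bump p R y = flat_exp 0 (R\<^sup>2 - (y - p) \<bullet> (y - p))"

lemma smooth_on_bump: assumes "open S" shows "smooth_on S (bump p R)"
proof -
  have d: "smooth_on S (\<lambda>y. y - p)"
    by (intro smooth_on_diff smooth_on_ident smooth_on_const assms)
  have "Ck_on k S (\<lambda>y. (y - p) \<bullet> (y - p))" for k
    by (rule bounded_bilinear.Ck_on[OF bounded_bilinear_inner assms])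
       (use d in \<open>simp_all add: smooth_on_def\<close>)
  then have "smooth_on S (\<lambda>y. (y - p) \<bullet> (y - p))" by (simp add: smooth_on_def)
  then have "smooth_on S (\<lambda>y. R\<^sup>2 - (y - p) \<bullet> (y - p))"
    by (intro smooth_on_diff smooth_on_const assms)
  from smooth_on_compose[OF assms open_UNIV smooth_on_flat_exp this] show ?thesis
    by (simp add: bump_def[abs_def])
qed

lemma bump_eq_dist: "bump p R y = flat_exp 0 (R\<^sup>2 - (dist p y)\<^sup>2)"
  unfolding bump_def by (metis dist_commute dist_norm power2_norm_eq_inner)

lemma bump_pos: "dist p y < R \<Longrightarrow> bump p R y > 0"
  using power_strict_mono[of "dist p y" R 2] unfolding bump_eq_dist flat_exp_def by simp

lemma bump_eq_0:
  assumes "0 < R" "R \<le> dist p y" shows "bump p R y = 0"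
proof -
  have "R\<^sup>2 \<le> (dist p y)\<^sup>2" using assms by (intro power_mono) auto
  then show ?thesis unfolding bump_eq_dist flat_exp_def by (simp add: not_less)
qed

section \<open>Charts, vector fields and tensor fields\<close>

locale smooth_atlas =
  fixes A :: "('m::{t2_space, second_countable_topology}, 'e::euclidean_space) chart set"
  assumes smooth_manifold: "smooth_manifold A"
begin

definition transition :: "('m, 'e) chart \<Rightarrow> ('m, 'e) chart \<Rightarrow> 'e \<Rightarrow> 'e" where
  "transition c d y = snd d (chart_inv c y)"

definition jacobian :: "('m, 'e) chart \<Rightarrow> ('m, 'e) chart \<Rightarrow> 'm \<Rightarrow> 'e \<Rightarrow> 'e" where
  "jacobian c d x = frechet_derivative (transition c d) (at (snd c x))"

abbreviation overlap :: "('m, 'e) chart \<Rightarrow> ('m, 'e) chart \<Rightarrow> 'e set" where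
  "overlap c d \<equiv> snd c ` (fst c \<inter> fst d)"

lemma chart_at: "chart_at A x \<in> A" "x \<in> fst (chart_at A x)"
proof -
  have "\<exists>c. c \<in> A \<and> x \<in> fst c"
    using smooth_manifold unfolding smooth_manifold_def by blast
  then have "chart_at A x \<in> A \<and> x \<in> fst (chart_at A x)"
    unfolding chart_at_def by (rule someI_ex)
  then show "chart_at A x \<in> A" "x \<in> fst (chart_at A x)" by auto
qed

context
  fixes c assumes c: "c \<in> A"
begin

lemma is_chart: "is_chart c"
  using smooth_manifold c unfolding smooth_manifold_def by blast

lemma open_domain: "open (fst c)"
  using is_chart unfolding is_chart_def by blast

lemma open_chart_image: "open (chart_image c)"
  using is_chart unfolding is_chart_def by blast

lemma continuous_chart_inv: "continuous_on (chart_image c) (chart_inv c)"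
  using is_chart unfolding is_chart_def homeomorphism_def by blast

lemma chart_inv_left [simp]: "x \<in> fst c \<Longrightarrow> chart_inv c (snd c x) = x"
  using is_chart unfolding is_chart_def homeomorphism_def by blast

lemma chart_inv_right [simp]: "y \<in> chart_image c \<Longrightarrow> snd c (chart_inv c y) = y"
  using is_chart unfolding is_chart_def homeomorphism_def by blast

lemma chart_inv_in [simp]: "y \<in> chart_image c \<Longrightarrow> chart_inv c y \<in> fst c"
  using is_chart unfolding is_chart_def homeomorphism_def by blast

lemma chart_image_in [simp]: "x \<in> fst c \<Longrightarrow> snd c x \<in> chart_image c"
  by (simp add: chart_image_def)

lemma overlap_eq: "overlap c d = chart_image c \<inter> chart_inv c -` fst d"
  by (force simp: chart_image_def)

lemma open_preimage_chart_inv: "open W \<Longrightarrow> open (chart_image c \<inter> chart_inv c -` W)"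
  by (rule continuous_open_preimage[OF continuous_chart_inv open_chart_image])

end

lemma open_overlap: "c \<in> A \<Longrightarrow> d \<in> A \<Longrightarrow> open (overlap c d)"
  by (simp add: overlap_eq open_preimage_chart_inv open_domain)

lemma smooth_transition: "c \<in> A \<Longrightarrow> d \<in> A \<Longrightarrow> smooth_on (overlap c d) (transition c d)"
  using smooth_manifold unfolding smooth_manifold_def transition_def[abs_def] comp_def by blast

lemma has_derivative_transition:
  assumes "c \<in> A" "d \<in> A" "x \<in> fst c" "x \<in> fst d"
  shows "(transition c d has_derivative jacobian c d x) (at (snd c x))"
  unfolding jacobian_def
  by (rule smooth_on_has_derivative[OF smooth_transition]) (use assms in auto)

lemma linear_jacobian:
  "c \<in> A \<Longrightarrow> d \<in> A \<Longrightarrow> x \<in> fst c \<Longrightarrow> x \<in> fst d \<Longrightarrow> linear (jacobian c d x)"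
  using has_derivative_transition has_derivative_linear by blast

lemma jacobian_self:
  assumes "c \<in> A" "x \<in> fst c" shows "jacobian c c x u = u"
proof -
  have "(transition c c has_derivative (\<lambda>u. u)) (at (snd c x))"
    by (rule has_derivative_transform_within_open[OF has_derivative_ident open_chart_image[OF assms(1)]])
       (use assms in \<open>auto simp: transition_def\<close>)
  then show ?thesis unfolding jacobian_def using frechet_derivative_at by metis
qed

text \<open>
  Pulling a map back along a change of charts: the chain rule in the form in which it is used
  for functions, for coordinate changes and for vector fields.
\<close>

lemma has_derivative_change_chart:
  assumes c: "c \<in> A" "x \<in> fst c" and d: "d \<in> A" "x \<in> fst d"
    and f: "(f has_derivative f') (at (snd d x))"
    and g: "\<And>z. z \<in> fst c \<Longrightarrow> z \<in> fst d \<Longrightarrow> g (snd c z) = f (snd d z)"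
  shows "(g has_derivative (\<lambda>u. f' (jacobian c d x u))) (at (snd c x))"
proof (rule has_derivative_transform_within_open[OF _ open_overlap[OF c(1) d(1)]])
  show "((\<lambda>y. f (transition c d y)) has_derivative (\<lambda>u. f' (jacobian c d x u))) (at (snd c x))"
    by (rule has_derivative_compose[OF has_derivative_transition[OF c(1) d(1) c(2) d(2)]])
       (use c d f in \<open>simp add: transition_def\<close>)
qed (use c d g in \<open>auto simp: transition_def\<close>)

lemma jacobian_compose:
  assumes "c \<in> A" "d \<in> A" "e \<in> A" "x \<in> fst c" "x \<in> fst d" "x \<in> fst e"
  shows "jacobian d e x (jacobian c d x u) = jacobian c e x u"
proof -
  have "(transition c e has_derivative (\<lambda>u. jacobian d e x (jacobian c d x u))) (at (snd c x))"
    by (rule has_derivative_change_chart[where f = "transition d e"])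
       (use assms has_derivative_transition in \<open>auto simp: transition_def\<close>)
  then show ?thesis
    using frechet_derivative_at unfolding jacobian_def by metis
qed

lemma components_eq: "components A d x = jacobian (chart_at A x) d x"
  unfolding components_def jacobian_def transition_def[abs_def] comp_def by (rule ext) rule

lemma coord_vector_eq: "coord_vector A c u x = jacobian c (chart_at A x) x u"
  unfolding coord_vector_def jacobian_def transition_def[abs_def] comp_def by rule

lemma linear_components: "c \<in> A \<Longrightarrow> x \<in> fst c \<Longrightarrow> linear (components A c x)"
  by (simp add: components_eq linear_jacobian chart_at)

lemma linear_coord_vector: "c \<in> A \<Longrightarrow> x \<in> fst c \<Longrightarrow> linear (\<lambda>u. coord_vector A c u x)"
  by (simp add: coord_vector_eq linear_jacobian chart_at)

lemma components_chart_at [simp]: "components A (chart_at A x) x v = v"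
  by (simp add: components_eq jacobian_self chart_at)

lemma components_coord_vector:
  "c \<in> A \<Longrightarrow> d \<in> A \<Longrightarrow> x \<in> fst c \<Longrightarrow> x \<in> fst d \<Longrightarrow>
    components A d x (coord_vector A c u x) = jacobian c d x u"
  by (simp add: components_eq coord_vector_eq jacobian_compose chart_at)

lemma coord_vector_components [simp]:
  "c \<in> A \<Longrightarrow> x \<in> fst c \<Longrightarrow> coord_vector A c (components A c x v) x = v"
  by (simp add: components_eq coord_vector_eq jacobian_compose jacobian_self chart_at)

lemma jacobian_components:
  "c \<in> A \<Longrightarrow> d \<in> A \<Longrightarrow> x \<in> fst c \<Longrightarrow> x \<in> fst d \<Longrightarrow>
    jacobian c d x (components A c x v) = components A d x v"
  by (simp add: components_eq jacobian_compose chart_at)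

lemma coord_vector_chart_at [simp]: "coord_vector A (chart_at A x) u x = u"
  by (simp add: coord_vector_eq jacobian_self chart_at)

lemma local_rep_chart: "c \<in> A \<Longrightarrow> x \<in> fst c \<Longrightarrow> local_rep A c X (snd c x) = components A c x (X x)"
  by (simp add: local_rep_def)

lemma local_rep_transition:
  "c \<in> A \<Longrightarrow> d \<in> A \<Longrightarrow> x \<in> fst c \<Longrightarrow> x \<in> fst d \<Longrightarrow>
    local_rep A d X (snd d x) = jacobian c d x (local_rep A c X (snd c x))"
  by (simp add: local_rep_chart jacobian_components)

lemma vector_fieldD: "X \<in> vector_fields A \<Longrightarrow> c \<in> A \<Longrightarrow> smooth_on (chart_image c) (local_rep A c X)"
  by (simp add: vector_fields_def)

text \<open>
  Smoothness of a vector field need only be checked in one chart around each point, because the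
  components in any other chart arise by applying the smooth family of Jacobians.
\<close>

lemma vector_field_if_locally_smooth:
  assumes "\<And>x. \<exists>c\<in>A. \<exists>U. x \<in> fst c \<and> open U \<and> snd c x \<in> U \<and> U \<subseteq> chart_image c \<and>
      smooth_on U (local_rep A c X)"
  shows "X \<in> vector_fields A"
  unfolding vector_fields_def mem_Collect_eq
proof (intro ballI smooth_on_local)
  fix d y assume d: "d \<in> A" and y: "y \<in> chart_image d"
  obtain c U where c: "c \<in> A" "chart_inv d y \<in> fst c" and U: "open U" "snd c (chart_inv d y) \<in> U"
    "U \<subseteq> chart_image c" "smooth_on U (local_rep A c X)"
    using assms[of "chart_inv d y"] by blast
  define W where "W = overlap d c \<inter> transition d c -` U"
  have W_sub: "W \<subseteq> overlap d c" by (auto simp: W_def)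
  have "open W"
    unfolding W_def
    by (rule continuous_open_preimage[OF smooth_on_continuous_on[OF smooth_transition[OF d c(1)]]
          open_overlap[OF d c(1)] U(1)])
  have in_W: "chart_inv d z \<in> fst c" "z \<in> chart_image d" "snd c (chart_inv d z) \<in> U" if "z \<in> W" for z
    using that by (auto simp: W_def overlap_eq[OF d] transition_def)
  note tr = smooth_on_subset[OF smooth_transition[OF d c(1)] W_sub]
  have sub: "transition d c ` W \<subseteq> overlap c d"
    using in_W d c(1) by (force simp: transition_def)
  have "smooth_on W (\<lambda>z. frechet_derivative (transition c d) (at (transition d c z))
      (local_rep A c X (transition d c z)))"
  proof (rule smooth_on_linear_family[where u = "\<lambda>z. local_rep A c X (transition d c z)"
        and L = "\<lambda>z. frechet_derivative (transition c d) (at (transition d c z))", OF \<open>open W\<close>])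
    show "linear (frechet_derivative (transition c d) (at (transition d c z)))" if "z \<in> W" for z
      by (rule smooth_on_linear_derivative[OF smooth_transition[OF c(1) d]]) (use sub that in auto)
    show "smooth_on W (\<lambda>z. frechet_derivative (transition c d) (at (transition d c z)) b)" for b
      by (rule smooth_on_compose[OF \<open>open W\<close> open_overlap[OF c(1) d]
            smooth_on_derivative[OF smooth_transition[OF c(1) d]] tr sub])
    show "smooth_on W (\<lambda>z. local_rep A c X (transition d c z))"
      by (rule smooth_on_compose[OF \<open>open W\<close> U(1,4) tr]) (auto simp: W_def)
  qed
  then have "smooth_on W (local_rep A d X)"
  proof (rule smooth_on_cong[OF \<open>open W\<close>, rotated])
    fix z assume z: "z \<in> W"
    show "frechet_derivative (transition c d) (at (transition d c z)) (local_rep A c X (transition d c z))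
        = local_rep A d X z"
      using local_rep_transition[OF c(1) d in_W(1)[OF z] chart_inv_in[OF d in_W(2)[OF z]], of X]
        in_W[OF z] d by (simp add: transition_def jacobian_def)
  qed
  moreover have "y \<in> W" using y c U d by (auto simp: W_def overlap_eq transition_def)
  ultimately show "\<exists>U. open U \<and> y \<in> U \<and> U \<subseteq> chart_image d \<and> smooth_on U (local_rep A d X)"
    using \<open>open W\<close> in_W(2) by blast
qed

lemma vector_field_add:
  assumes "X \<in> vector_fields A" "Y \<in> vector_fields A" shows "(\<lambda>z. X z + Y z) \<in> vector_fields A"
  unfolding vector_fields_def mem_Collect_eq
proof
  fix c assume c: "c \<in> A"
  show "smooth_on (chart_image c) (local_rep A c (\<lambda>z. X z + Y z))"
    by (rule smooth_on_cong[OF open_chart_image[OF c] _ smooth_on_add[OF open_chart_image[OF c]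
            vector_fieldD[OF assms(1) c] vector_fieldD[OF assms(2) c]]])
       (simp add: local_rep_def linear_add[OF linear_components[OF c chart_inv_in[OF c]]])
qed

subsection \<open>Smooth functions and their derivatives along vector fields\<close>

lemma smooth_funD: "smooth_fun A f \<Longrightarrow> c \<in> A \<Longrightarrow> smooth_on (chart_image c) (\<lambda>y. f (chart_inv c y))"
  by (simp add: smooth_fun_def comp_def)

lemma smooth_funI: "(\<And>c. c \<in> A \<Longrightarrow> smooth_on (chart_image c) (\<lambda>y. f (chart_inv c y))) \<Longrightarrow> smooth_fun A f"
  by (simp add: smooth_fun_def comp_def)

lemma smooth_fun_add: "smooth_fun A f \<Longrightarrow> smooth_fun A g \<Longrightarrow> smooth_fun A (\<lambda>z. f z + g z)"
  by (rule smooth_funI) (simp add: smooth_on_add smooth_funD open_chart_image)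

lemma smooth_fun_mult: "smooth_fun A f \<Longrightarrow> smooth_fun A g \<Longrightarrow> smooth_fun A (\<lambda>z. f z * g z)"
  by (rule smooth_funI) (simp add: smooth_on_mult smooth_funD open_chart_image)

lemma smooth_fun_diff: "smooth_fun A f \<Longrightarrow> smooth_fun A g \<Longrightarrow> smooth_fun A (\<lambda>z. f z - g z)"
  by (rule smooth_funI) (simp add: smooth_on_diff smooth_funD open_chart_image)

lemma smooth_fun_sum: "(\<And>i. i \<in> I \<Longrightarrow> smooth_fun A (f i)) \<Longrightarrow> smooth_fun A (\<lambda>z. \<Sum>i\<in>I. f i z)"
  by (rule smooth_funI) (simp add: smooth_on_sum smooth_funD open_chart_image)

lemma smooth_fun_has_derivative:
  assumes "smooth_fun A f" "c \<in> A" "x \<in> fst c"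
  shows "((\<lambda>y. f (chart_inv c y)) has_derivative
      frechet_derivative (\<lambda>y. f (chart_inv c y)) (at (snd c x))) (at (snd c x))"
  using smooth_on_has_derivative[OF smooth_funD[OF assms(1,2)]] assms(2,3) by simp

lemma dir_deriv_eq_chart_at:
  "dir_deriv A X f x =
    frechet_derivative (\<lambda>y. f (chart_inv (chart_at A x) y)) (at (snd (chart_at A x) x)) (X x)"
  by (simp add: dir_deriv_def comp_def)

lemma dir_deriv_eqI:
  assumes "((\<lambda>y. f (chart_inv (chart_at A x) y)) has_derivative f') (at (snd (chart_at A x) x))"
  shows "dir_deriv A X f x = f' (X x)"
  unfolding dir_deriv_eq_chart_at using frechet_derivative_at[OF assms] by metis

lemma dir_deriv_chart:
  assumes f: "smooth_fun A f" and c: "c \<in> A" "x \<in> fst c"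
  shows "dir_deriv A X f x =
    frechet_derivative (\<lambda>y. f (chart_inv c y)) (at (snd c x)) (components A c x (X x))"
proof -
  have "((\<lambda>y. f (chart_inv (chart_at A x) y)) has_derivative
      (\<lambda>u. frechet_derivative (\<lambda>y. f (chart_inv c y)) (at (snd c x)) (jacobian (chart_at A x) c x u)))
      (at (snd (chart_at A x) x))"
    by (rule has_derivative_change_chart[OF chart_at c smooth_fun_has_derivative[OF f c]])
       (use c chart_at in auto)
  from dir_deriv_eqI[OF this] show ?thesis by (simp add: components_eq)
qed

lemma smooth_fun_dir_deriv:
  assumes f: "smooth_fun A f" and X: "X \<in> vector_fields A" shows "smooth_fun A (dir_deriv A X f)"
proof (rule smooth_funI)
  fix c assume c: "c \<in> A"
  have "smooth_on (chart_image c)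
      (\<lambda>y. frechet_derivative (\<lambda>y. f (chart_inv c y)) (at y) (local_rep A c X y))"
    by (rule smooth_on_linear_family[OF open_chart_image[OF c] smooth_on_linear_derivative[OF
            smooth_funD[OF f c]] smooth_on_derivative[OF smooth_funD[OF f c]] vector_fieldD[OF X c]])
  then show "smooth_on (chart_image c) (\<lambda>y. dir_deriv A X f (chart_inv c y))"
    by (rule smooth_on_cong[OF open_chart_image[OF c], rotated])
       (simp add: dir_deriv_chart[OF f c chart_inv_in[OF c]] local_rep_def c)
qed

lemma dir_deriv_const [simp]: "dir_deriv A X (\<lambda>z. a) x = 0"
  by (simp add: dir_deriv_eq_chart_at)

lemma dir_deriv_add:
  assumes "smooth_fun A f" "smooth_fun A g"
  shows "dir_deriv A X (\<lambda>z. f z + g z) x = dir_deriv A X f x + dir_deriv A X g x"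
  unfolding dir_deriv_eqI[OF has_derivative_add[OF assms[THEN smooth_fun_has_derivative, OF chart_at]]]
  by (simp add: dir_deriv_eq_chart_at)

lemma dir_deriv_mult:
  assumes "smooth_fun A f" "smooth_fun A g"
  shows "dir_deriv A X (\<lambda>z. f z * g z) x = dir_deriv A X f x * g x + f x * dir_deriv A X g x"
  unfolding dir_deriv_eqI[OF has_derivative_mult[OF assms[THEN smooth_fun_has_derivative, OF chart_at]]]
  by (simp add: dir_deriv_eq_chart_at chart_at)

lemma dir_deriv_sum:
  assumes "\<And>i. i \<in> I \<Longrightarrow> smooth_fun A (f i)"
  shows "dir_deriv A X (\<lambda>z. \<Sum>i\<in>I. f i z) x = (\<Sum>i\<in>I. dir_deriv A X (f i) x)"
  using assms
proof (induction I rule: infinite_finite_induct)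
  case (insert i I)
  then show ?case by (simp add: dir_deriv_add smooth_fun_sum)
qed simp_all

lemma vector_field_scaleR:
  assumes "smooth_fun A f" "X \<in> vector_fields A" shows "(\<lambda>z. f z *\<^sub>R X z) \<in> vector_fields A"
  unfolding vector_fields_def mem_Collect_eq
proof
  fix c assume c: "c \<in> A"
  show "smooth_on (chart_image c) (local_rep A c (\<lambda>z. f z *\<^sub>R X z))"
    by (rule smooth_on_cong[OF open_chart_image[OF c] _ smooth_on_scaleR[OF open_chart_image[OF c]
            smooth_funD[OF assms(1) c] vector_fieldD[OF assms(2) c]]])
       (simp add: local_rep_def linear_cmul[OF linear_components[OF c chart_inv_in[OF c]]])
qed

subsection \<open>Evaluating tensor fields on vector fields\<close>

lemma smooth_fun_one_form:
  assumes t: "one_form A t" and X: "X \<in> vector_fields A" shows "smooth_fun A (\<lambda>z. t z (X z))"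
proof (rule smooth_funI)
  fix c assume c: "c \<in> A"
  let ?t = "\<lambda>y u. t (chart_inv c y) (coord_vector A c u (chart_inv c y))"
  have "smooth_on (chart_image c) (\<lambda>y. ?t y (local_rep A c X y))"
  proof (rule smooth_on_linear_family[OF open_chart_image[OF c] _ _ vector_fieldD[OF X c]])
    show "linear (?t y)" if "y \<in> chart_image c" for y
      using linear_compose[OF linear_coord_vector[OF c chart_inv_in[OF c that]]] t
      by (auto simp: one_form_def comp_def)
    show "smooth_on (chart_image c) (\<lambda>y. ?t y b)" for b
      using t c by (auto simp: one_form_def comp_def)
  qed
  then show "smooth_on (chart_image c) (\<lambda>y. t (chart_inv c y) (X (chart_inv c y)))"
    by (rule smooth_on_cong[OF open_chart_image[OF c], rotated]) (simp add: local_rep_def c)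
qed

lemma bilinear_comp_linear:
  assumes "bilinear B" "linear f" shows "bilinear (\<lambda>u w. B (f u) (f w))"
  using assms linear_compose[OF assms(2), of "B _"] linear_compose[OF assms(2), of "\<lambda>u. B u _"]
  by (simp add: bilinear_def comp_def)

lemma linear_comp_bilinear:
  assumes "bilinear B" "linear f" shows "bilinear (\<lambda>u w. f (B u w))"
  using assms linear_compose[of "B _" f] linear_compose[of "\<lambda>u. B u _" f]
  by (simp add: bilinear_def comp_def)

abbreviation metric_rep :: "('m \<Rightarrow> 'e \<Rightarrow> 'e \<Rightarrow> real) \<Rightarrow> ('m, 'e) chart \<Rightarrow> 'e \<Rightarrow> 'e \<Rightarrow> 'e \<Rightarrow> real" where
  "metric_rep h c y u w \<equiv>
    h (chart_inv c y) (coord_vector A c u (chart_inv c y)) (coord_vector A c w (chart_inv c y))"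

lemma bilinear_metric_rep:
  assumes "symmetric_tensor_field A h" "c \<in> A" "y \<in> chart_image c" shows "bilinear (metric_rep h c y)"
  using assms(1)
  by (intro bilinear_comp_linear[where B = "h (chart_inv c y)", OF _ linear_coord_vector[OF assms(2) chart_inv_in[OF assms(2,3)]]])
     (simp add: symmetric_tensor_field_def)

lemma smooth_metric_rep:
  assumes "symmetric_tensor_field A h" "c \<in> A"
  shows "smooth_on (chart_image c) (\<lambda>y. metric_rep h c y u w)"
  using assms by (auto simp: symmetric_tensor_field_def comp_def)

lemma smooth_fun_metric:
  assumes h: "symmetric_tensor_field A h" and X: "X \<in> vector_fields A" and Y: "Y \<in> vector_fields A"
  shows "smooth_fun A (\<lambda>z. h z (X z) (Y z))"
proof (rule smooth_funI)
  fix c assume c: "c \<in> A"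
  have "smooth_on (chart_image c) (\<lambda>y. metric_rep h c y (local_rep A c X y) (local_rep A c Y y))"
    by (rule smooth_on_bilinear_family[OF open_chart_image[OF c] bilinear_metric_rep[OF h c]
          smooth_metric_rep[OF h c] vector_fieldD[OF X c] vector_fieldD[OF Y c]])
  then show "smooth_on (chart_image c) (\<lambda>y. h (chart_inv c y) (X (chart_inv c y)) (Y (chart_inv c y)))"
    by (rule smooth_on_cong[OF open_chart_image[OF c], rotated]) (simp add: local_rep_def c)
qed

lemma vector_field_torsion_tensor:
  assumes T: "torsion_tensor A T" and X: "X \<in> vector_fields A" and Y: "Y \<in> vector_fields A"
  shows "(\<lambda>z. T z (X z) (Y z)) \<in> vector_fields A"
  unfolding vector_fields_def mem_Collect_eq
proof
  fix c assume c: "c \<in> A"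
  let ?T = "\<lambda>y u w. local_rep A c (\<lambda>x. T x (coord_vector A c u x) (coord_vector A c w x)) y"
  have "smooth_on (chart_image c) (\<lambda>y. ?T y (local_rep A c X y) (local_rep A c Y y))"
  proof (rule smooth_on_bilinear_family[where B = ?T, OF open_chart_image[OF c] _ _ vector_fieldD[OF X c] vector_fieldD[OF Y c]])
    show "bilinear (?T y)" if "y \<in> chart_image c" for y
      unfolding local_rep_def
      by (rule linear_comp_bilinear[OF bilinear_comp_linear[where B = "T (chart_inv c y)", OF _
              linear_coord_vector[OF c chart_inv_in[OF c that]]] linear_components[OF c chart_inv_in[OF c that]]])
         (use T in \<open>simp add: torsion_tensor_def\<close>)
    show "smooth_on (chart_image c) (\<lambda>y. ?T y u w)" for u w
      using T c unfolding torsion_tensor_def by blast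
  qed
  then show "smooth_on (chart_image c) (local_rep A c (\<lambda>z. T z (X z) (Y z)))"
    by (rule smooth_on_cong[OF open_chart_image[OF c], rotated]) (simp add: local_rep_def c)
qed

subsection \<open>The Lie bracket\<close>

text \<open>
  The bracket is defined through the chart selected at the point.  In any other chart the
  components of a field are \<open>\<Phi>\<^sub>y (Y y)\<close> with \<open>\<Phi>\<close> the Jacobian of the change of charts, so
  differentiating them along \<open>X\<close> produces the second derivative of the change of charts at
  \<open>(X, Y)\<close>.  This term is symmetric and cancels in the bracket.
\<close>

lemma components_lie_bracket:
  assumes X: "X \<in> vector_fields A" and Y: "Y \<in> vector_fields A" and c: "c \<in> A" "x \<in> fst c"
  shows "components A c x (lie_bracket A X Y x) =
      frechet_derivative (local_rep A c Y) (at (snd c x)) (components A c x (X x))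
    - frechet_derivative (local_rep A c X) (at (snd c x)) (components A c x (Y x))"
proof -
  define b where "b = chart_at A x"
  have b: "b \<in> A" "x \<in> fst b" using chart_at by (auto simp: b_def)
  let ?\<phi> = "transition b c"
  let ?H = "\<lambda>u v. frechet_derivative (\<lambda>y. frechet_derivative ?\<phi> (at y) u) (at (snd b x)) v"
  note ov = open_overlap[OF b(1) c(1)] and tr = smooth_transition[OF b(1) c(1)]
  have xb: "snd b x \<in> overlap b c" using b c by auto
  have lin: "linear (jacobian b c x)" using linear_jacobian b c by blast
  have key: "frechet_derivative (local_rep A c Z) (at (snd c x)) (jacobian b c x v)
      = ?H (Z x) v + jacobian b c x (frechet_derivative (local_rep A b Z) (at (snd b x)) v)"
    if Z: "Z \<in> vector_fields A" for Z v
  proof -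
    have eq: "local_rep A c Z (snd c z) = frechet_derivative ?\<phi> (at (snd b z)) (local_rep A b Z (snd b z))"
      if "z \<in> fst b" "z \<in> fst c" for z
      using local_rep_transition[OF b(1) c(1) that] unfolding jacobian_def .
    have "((\<lambda>y. frechet_derivative ?\<phi> (at y) (local_rep A b Z y)) has_derivative
        (\<lambda>v. ?H (local_rep A b Z (snd b x)) v
          + frechet_derivative ?\<phi> (at (snd b x)) (frechet_derivative (local_rep A b Z) (at (snd b x)) v)))
        (at (snd b x))"
      by (rule has_derivative_linear_family[OF ov xb smooth_on_linear_derivative[OF tr]
            smooth_on_differentiable[OF smooth_on_derivative[OF tr] xb]
            smooth_on_has_derivative[OF vector_fieldD[OF Z b(1)]]])
         (use b in simp_all)
    moreover have "((\<lambda>y. frechet_derivative ?\<phi> (at y) (local_rep A b Z y)) has_derivative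
        (\<lambda>v. frechet_derivative (local_rep A c Z) (at (snd c x)) (jacobian b c x v))) (at (snd b x))"
      by (rule has_derivative_change_chart[OF b c smooth_on_has_derivative[OF vector_fieldD[OF Z c(1)]]])
         (use c eq in simp_all)
    ultimately have "(\<lambda>v. frechet_derivative (local_rep A c Z) (at (snd c x)) (jacobian b c x v))
      = (\<lambda>v. ?H (local_rep A b Z (snd b x)) v
          + frechet_derivative ?\<phi> (at (snd b x)) (frechet_derivative (local_rep A b Z) (at (snd b x)) v))"
      using has_derivative_unique by blast
    moreover have "local_rep A b Z (snd b x) = Z x"
      using local_rep_chart[OF b] by (simp add: b_def)
    ultimately show ?thesis by (simp add: fun_eq_iff jacobian_def)
  qed
  have comp: "components A c x = jacobian b c x"
    by (simp add: components_eq b_def)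
  have "?H (Y x) (X x) = ?H (X x) (Y x)"
    by (rule second_derivative_symmetric[OF ov xb tr])
  then show ?thesis
    unfolding comp key[OF X] key[OF Y] lie_bracket_def Let_def b_def[symmetric]
    by (simp add: linear_diff[OF lin])
qed

lemma vector_field_lie_bracket:
  assumes X: "X \<in> vector_fields A" and Y: "Y \<in> vector_fields A"
  shows "lie_bracket A X Y \<in> vector_fields A"
  unfolding vector_fields_def mem_Collect_eq
proof
  fix c assume c: "c \<in> A"
  have D: "smooth_on (chart_image c)
      (\<lambda>y. frechet_derivative (local_rep A c Z) (at y) (local_rep A c W y))"
    if "Z \<in> vector_fields A" "W \<in> vector_fields A" for Z W
    by (rule smooth_on_linear_family[OF open_chart_image[OF c] smooth_on_linear_derivative[OF
            vector_fieldD[OF that(1) c]] smooth_on_derivative[OF vector_fieldD[OF that(1) c]]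
            vector_fieldD[OF that(2) c]])
  show "smooth_on (chart_image c) (local_rep A c (lie_bracket A X Y))"
    by (rule smooth_on_cong[OF open_chart_image[OF c] _ smooth_on_diff[OF open_chart_image[OF c]
            D[OF Y X] D[OF X Y]]])
       (simp add: local_rep_def components_lie_bracket[OF X Y c chart_inv_in[OF c]] c)
qed

subsection \<open>Globally defined vector fields with prescribed components near a point\<close>

text \<open>
  Cutting off coordinate fields makes every tangent vector the value of a global vector field, and
  makes every chart carry, near each of its points, a frame of global fields.  By the first fact
  vectors can be compared by pairing them with global fields, by the second the components of a
  field in a chart can be recovered from such pairings.
\<close>

definition bump_field :: "('m, 'e) chart \<Rightarrow> 'e \<Rightarrow> real \<Rightarrow> 'e \<Rightarrow> 'm \<Rightarrow> 'e" where
  "bump_field c p R u x = (if x \<in> fst c then bump p R (snd c x) *\<^sub>R coord_vector A c u x else 0)"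

lemma local_rep_bump_field:
  assumes "c \<in> A" "y \<in> chart_image c"
  shows "local_rep A c (bump_field c p R u) y = bump p R y *\<^sub>R u"
  using assms linear_cmul[OF linear_components[OF assms(1) chart_inv_in[OF assms]]]
  by (simp add: local_rep_def bump_field_def components_coord_vector jacobian_self)

text \<open>
  Extension by zero is smooth because the closed ball supporting the bump has a compact, hence
  closed, preimage in \<open>M\<close>.  This is where the Hausdorff property is needed.
\<close>

lemma vector_field_bump_field:
  assumes c: "c \<in> A" and R: "0 < R" "cball p R \<subseteq> chart_image c"
  shows "bump_field c p R u \<in> vector_fields A" (is "?Z \<in> _")
proof (rule vector_field_if_locally_smooth)
  fix x
  show "\<exists>d\<in>A. \<exists>U. x \<in> fst d \<and> open U \<and> snd d x \<in> U \<and> U \<subseteq> chart_image d \<and> smooth_on U (local_rep A d ?Z)"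
  proof (cases "x \<in> fst c")
    case True
    have "smooth_on (chart_image c) (\<lambda>y. bump p R y *\<^sub>R u)"
      using open_chart_image[OF c] by (simp add: smooth_on_scaleR smooth_on_bump)
    then have "smooth_on (chart_image c) (local_rep A c ?Z)"
      by (rule smooth_on_cong[OF open_chart_image[OF c], rotated]) (simp add: local_rep_bump_field[OF c])
    with True c open_chart_image[OF c] show ?thesis by (meson chart_image_in order_refl)
  next
    case False
    define K where "K = chart_inv c ` cball p R"
    have "compact K"
      unfolding K_def using continuous_on_subset[OF continuous_chart_inv[OF c] R(2)]
      by (rule compact_continuous_image) simp
    then have "open (- K)" using compact_imp_closed by blast
    have zero: "?Z z = 0" if "z \<notin> K" for z
    proof (cases "z \<in> fst c")
      case True
      then have "snd c z \<notin> cball p R"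
        using that c unfolding K_def by (metis chart_inv_left image_eqI)
      then show ?thesis using R(1) by (simp add: bump_field_def bump_eq_0)
    qed (simp add: bump_field_def)
    define d where "d = chart_at A x"
    have d: "d \<in> A" "x \<in> fst d" using chart_at by (auto simp: d_def)
    define U where "U = chart_image d \<inter> chart_inv d -` (- K)"
    have "open U" unfolding U_def by (rule open_preimage_chart_inv[OF d(1) \<open>open (- K)\<close>])
    moreover have "smooth_on U (local_rep A d ?Z)"
      by (rule smooth_on_cong[where f = "\<lambda>_. 0", OF \<open>open U\<close> _ smooth_on_const[OF \<open>open U\<close>]])
         (use d in \<open>auto simp: U_def local_rep_def zero linear_0[OF linear_components]\<close>)
    moreover have "x \<notin> K" using False R(2) chart_inv_in[OF c] unfolding K_def by blast
    ultimately show ?thesis using d unfolding U_def by (intro bexI[of _ d] exI[of _ U]) (auto simp: U_def)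
  qed
qed

lemma exists_vector_field_through:
  obtains Z where "Z \<in> vector_fields A" "Z x = v"
proof -
  define c where "c = chart_at A x"
  have c: "c \<in> A" "x \<in> fst c" using chart_at by (auto simp: c_def)
  obtain R where R: "R > 0" "cball (snd c x) R \<subseteq> chart_image c"
    using open_contains_cball[of "chart_image c"] open_chart_image[OF c(1)] chart_image_in[OF c] by blast
  have pos: "bump (snd c x) R (snd c x) > 0" using R(1) by (simp add: bump_pos)
  show ?thesis
  proof
    show "bump_field c (snd c x) R (v /\<^sub>R bump (snd c x) R (snd c x)) \<in> vector_fields A"
      by (rule vector_field_bump_field[OF c(1) R])
    show "bump_field c (snd c x) R (v /\<^sub>R bump (snd c x) R (snd c x)) x = v"
      using c pos by (simp add: bump_field_def) (simp add: c_def)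
  qed
qed

end

section \<open>The metric connection with prescribed torsion\<close>

context smooth_atlas
begin

text \<open>
  Derivatives of components in the chart selected at the point.  They are not tensorial on their
  own; they serve to write covariant derivatives, brackets and derivatives of \<open>h(X, Y)\<close> at one
  point by means of linear maps.
\<close>

definition field_deriv :: "('m \<Rightarrow> 'e) \<Rightarrow> 'm \<Rightarrow> 'e \<Rightarrow> 'e" where
  "field_deriv X x = frechet_derivative (local_rep A (chart_at A x) X) (at (snd (chart_at A x) x))"

definition metric_deriv :: "('m \<Rightarrow> 'e \<Rightarrow> 'e \<Rightarrow> real) \<Rightarrow> 'm \<Rightarrow> 'e \<Rightarrow> 'e \<Rightarrow> 'e \<Rightarrow> real" where
  "metric_deriv h x v u w =
    frechet_derivative (\<lambda>y. metric_rep h (chart_at A x) y u w) (at (snd (chart_at A x) x)) v"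

lemma local_rep_has_derivative:
  assumes "X \<in> vector_fields A"
  shows "(local_rep A (chart_at A x) X has_derivative field_deriv X x) (at (snd (chart_at A x) x))"
  unfolding field_deriv_def
  by (rule smooth_on_has_derivative[OF vector_fieldD[OF assms chart_at(1)]]) (simp add: chart_at)

lemma local_rep_chart_at: "local_rep A (chart_at A x) X (snd (chart_at A x) x) = X x"
  by (simp add: local_rep_chart chart_at)

lemma linear_field_deriv: "X \<in> vector_fields A \<Longrightarrow> linear (field_deriv X x)"
  using local_rep_has_derivative has_derivative_linear by blast

lemma field_deriv_add:
  assumes "X \<in> vector_fields A" "Y \<in> vector_fields A"
  shows "field_deriv (\<lambda>z. X z + Y z) x v = field_deriv X x v + field_deriv Y x v"
proof -
  let ?c = "chart_at A x"
  have D: "(local_rep A ?c (\<lambda>z. X z + Y z) has_derivative (\<lambda>v. field_deriv X x v + field_deriv Y x v))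
      (at (snd ?c x))"
    by (rule has_derivative_transform_within_open[OF has_derivative_add[OF
            assms[THEN local_rep_has_derivative]] open_chart_image[OF chart_at(1)[of x]]])
       (simp_all add: chart_at local_rep_def linear_add[OF linear_components])
  show ?thesis
    unfolding field_deriv_def[of "\<lambda>z. X z + Y z"] frechet_derivative_at[OF D, symmetric] ..
qed

lemma field_deriv_scaleR:
  assumes f: "smooth_fun A f" and X: "X \<in> vector_fields A"
  shows "field_deriv (\<lambda>z. f z *\<^sub>R X z) x (Y x) =
    dir_deriv A Y f x *\<^sub>R X x + f x *\<^sub>R field_deriv X x (Y x)"
proof -
  let ?c = "chart_at A x"
  have D: "(local_rep A ?c (\<lambda>z. f z *\<^sub>R X z) has_derivative (\<lambda>v. f x *\<^sub>R field_deriv X x v +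
      frechet_derivative (\<lambda>y. f (chart_inv ?c y)) (at (snd ?c x)) v *\<^sub>R X x)) (at (snd ?c x))"
    by (rule has_derivative_transform_within_open[OF has_derivative_scaleR[OF
            smooth_fun_has_derivative[OF f chart_at] local_rep_has_derivative[OF X],
            unfolded chart_inv_left[OF chart_at] local_rep_chart_at] open_chart_image[OF chart_at(1)[of x]]])
       (simp_all add: chart_at local_rep_def linear_cmul[OF linear_components])
  have "field_deriv (\<lambda>z. f z *\<^sub>R X z) x v = f x *\<^sub>R field_deriv X x v +
      frechet_derivative (\<lambda>y. f (chart_inv ?c y)) (at (snd ?c x)) v *\<^sub>R X x" for v
    unfolding field_deriv_def[of "\<lambda>z. f z *\<^sub>R X z"] frechet_derivative_at[OF D, symmetric] ..
  then show ?thesis by (simp add: dir_deriv_eq_chart_at)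
qed

lemma lie_bracket_eq: "lie_bracket A X Y x = field_deriv Y x (X x) - field_deriv X x (Y x)"
  by (simp add: lie_bracket_def Let_def field_deriv_def)

end

locale metric_with_torsion = smooth_atlas A
  for A :: "('m::{t2_space, second_countable_topology}, 'e::euclidean_space) chart set" +
  fixes h :: "'m \<Rightarrow> 'e \<Rightarrow> 'e \<Rightarrow> real" and T :: "'m \<Rightarrow> 'e \<Rightarrow> 'e \<Rightarrow> 'e"
  assumes metric: "symmetric_tensor_field A h"
    and nondegenerate: "\<And>x v. (\<And>w. h x v w = 0) \<Longrightarrow> v = 0"
    and torsion_tensor: "torsion_tensor A T"
begin

lemma bilinear_h: "bilinear (h x)" and h_sym: "h x u w = h x w u"
  using metric by (auto simp: symmetric_tensor_field_def)

lemma linear_h: "linear (h x u)" and linear_h_left: "linear (\<lambda>u. h x u w)"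
  using bilinear_h by (auto simp: bilinear_def)

lemmas h_simps = linear_add[OF linear_h] linear_diff[OF linear_h] linear_cmul[OF linear_h]
  linear_neg[OF linear_h] linear_0[OF linear_h]
  linear_add[OF linear_h_left] linear_diff[OF linear_h_left] linear_cmul[OF linear_h_left]
  linear_neg[OF linear_h_left] linear_0[OF linear_h_left]

lemma h_eqI: assumes "\<And>z. h x u z = h x w z" shows "u = w"
proof -
  have "u - w = 0" by (rule nondegenerate[of x]) (simp add: h_simps assms)
  then show ?thesis by simp
qed

lemma h_eqI_fields:
  assumes "\<And>Z. Z \<in> vector_fields A \<Longrightarrow> h x u (Z x) = h x w (Z x)" shows "u = w"
proof (rule h_eqI)
  fix z
  obtain Z where "Z \<in> vector_fields A" "Z x = z" by (rule exists_vector_field_through)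
  then show "h x u z = h x w z" using assms by blast
qed

lemma bilinear_T: "bilinear (T x)" and T_anti: "T x u w = - T x w u"
  using torsion_tensor unfolding torsion_tensor_def by blast+

lemma linear_T: "linear (T x u)" and linear_T_left: "linear (\<lambda>u. T x u w)"
  using bilinear_T by (auto simp: bilinear_def)

lemmas T_simps = linear_add[OF linear_T] linear_cmul[OF linear_T]
  linear_add[OF linear_T_left] linear_cmul[OF linear_T_left]

lemma metric_rep_differentiable:
  "(\<lambda>y. metric_rep h (chart_at A x) y u w) differentiable (at (snd (chart_at A x) x))"
  by (rule smooth_on_differentiable[OF smooth_metric_rep[OF metric chart_at(1)]]) (simp add: chart_at)

lemma metric_deriv_sym: "metric_deriv h x v u w = metric_deriv h x v w u"
  unfolding metric_deriv_def by (subst h_sym) (rule refl)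

lemma linear_metric_deriv:
  "linear (\<lambda>v. metric_deriv h x v u w)" "linear (metric_deriv h x v u)" "linear (\<lambda>u. metric_deriv h x v u w)"
proof -
  show "linear (\<lambda>v. metric_deriv h x v u w)"
    unfolding metric_deriv_def by (rule linear_frechet_derivative[OF metric_rep_differentiable])
  have rep: "linear (metric_rep h (chart_at A x) y u)" if "y \<in> chart_image (chart_at A x)" for y u
    using bilinear_metric_rep[OF metric chart_at(1) that] by (simp add: bilinear_def)
  show lin: "linear (metric_deriv h x v u)" for u
    unfolding metric_deriv_def[abs_def]
    by (rule linear_derivative_of_family[OF open_chart_image[OF chart_at(1)]
          chart_image_in[OF chart_at] rep metric_rep_differentiable])
  show "linear (\<lambda>u. metric_deriv h x v u w)"
    unfolding metric_deriv_sym[of x v _ w] by (rule lin)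
qed

lemmas metric_deriv_simps = linear_add[OF linear_metric_deriv(1)] linear_cmul[OF linear_metric_deriv(1)]
  linear_add[OF linear_metric_deriv(2)] linear_cmul[OF linear_metric_deriv(2)]
  linear_add[OF linear_metric_deriv(3)] linear_cmul[OF linear_metric_deriv(3)]

lemma dir_deriv_metric:
  assumes X: "X \<in> vector_fields A" and Y: "Y \<in> vector_fields A"
  shows "dir_deriv A Z (\<lambda>z. h z (X z) (Y z)) x = metric_deriv h x (Z x) (X x) (Y x)
      + h x (field_deriv X x (Z x)) (Y x) + h x (X x) (field_deriv Y x (Z x))"
proof -
  let ?c = "chart_at A x"
  have "((\<lambda>y. metric_rep h ?c y (local_rep A ?c X y) (local_rep A ?c Y y)) has_derivative
      (\<lambda>v. metric_deriv h x v (X x) (Y x) + h x (field_deriv X x v) (Y x) + h x (X x) (field_deriv Y x v)))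
      (at (snd ?c x))"
    using has_derivative_bilinear_family[where B = "metric_rep h ?c", OF open_chart_image[OF chart_at(1)]
        chart_image_in[OF chart_at] bilinear_metric_rep[OF metric chart_at(1)]
        metric_rep_differentiable local_rep_has_derivative[OF X] local_rep_has_derivative[OF Y]]
    by (simp add: local_rep_chart_at chart_at metric_deriv_def)
  then have "((\<lambda>y. h (chart_inv ?c y) (X (chart_inv ?c y)) (Y (chart_inv ?c y))) has_derivative
      (\<lambda>v. metric_deriv h x v (X x) (Y x) + h x (field_deriv X x v) (Y x) + h x (X x) (field_deriv Y x v)))
      (at (snd ?c x))"
    by (rule has_derivative_transform_within_open[OF _ open_chart_image[OF chart_at(1)]
          chart_image_in[OF chart_at]]) (simp add: local_rep_def chart_at)
  from dir_deriv_eqI[OF this] show ?thesis .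
qed

text \<open>
  Twice the value of \<open>h(\<nabla>\<^sub>X Y, Z)\<close> forced by \<open>\<nabla>h = 0\<close> and torsion \<open>T\<close>: the usual Koszul expression with
  each bracket \<open>[X, Y]\<close> replaced by \<open>[X, Y] + T(X, Y)\<close>, which is \<open>\<nabla>\<^sub>X Y - \<nabla>\<^sub>Y X\<close>.
\<close>

definition koszul :: "('m \<Rightarrow> 'e) \<Rightarrow> ('m \<Rightarrow> 'e) \<Rightarrow> ('m \<Rightarrow> 'e) \<Rightarrow> 'm \<Rightarrow> real" where
  "koszul X Y Z x =
      dir_deriv A X (\<lambda>z. h z (Y z) (Z z)) x + dir_deriv A Y (\<lambda>z. h z (X z) (Z z)) x
    - dir_deriv A Z (\<lambda>z. h z (X z) (Y z)) x
    + h x (lie_bracket A X Y x + T x (X x) (Y x)) (Z x)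
    + h x (lie_bracket A Z X x + T x (Z x) (X x)) (Y x)
    + h x (lie_bracket A Z Y x + T x (Z x) (Y x)) (X x)"

lemma smooth_fun_koszul:
  assumes "X \<in> vector_fields A" "Y \<in> vector_fields A" "Z \<in> vector_fields A"
  shows "smooth_fun A (koszul X Y Z)"
  unfolding koszul_def[abs_def]
  by (intro smooth_fun_add smooth_fun_diff smooth_fun_dir_deriv smooth_fun_metric[OF metric]
      vector_field_add vector_field_lie_bracket vector_field_torsion_tensor[OF torsion_tensor] assms)

text \<open>
  Replace every derivative of \<open>h\<close> by compatibility and every \<open>[X, Y] + T(X, Y)\<close> by
  \<open>\<nabla>\<^sub>X Y - \<nabla>\<^sub>Y X\<close>; all terms but two cancel.  The operation \<open>D\<close> is arbitrary so that the identity
  is available for a pointwise defined connection in order to prove that it produces vector fields.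
\<close>

lemma koszul_if_compatible:
  assumes compat: "\<And>X Y Z x. X \<in> vector_fields A \<Longrightarrow> Y \<in> vector_fields A \<Longrightarrow> Z \<in> vector_fields A \<Longrightarrow>
      cov_deriv_metric A D Z h X Y x = 0"
    and tors: "\<And>X Y x. X \<in> vector_fields A \<Longrightarrow> Y \<in> vector_fields A \<Longrightarrow>
      torsion A D X Y x = T x (X x) (Y x)"
    and XYZ: "X \<in> vector_fields A" "Y \<in> vector_fields A" "Z \<in> vector_fields A"
  shows "2 * h x (D X Y x) (Z x) = koszul X Y Z x"
proof -
  have d: "dir_deriv A Z (\<lambda>z. h z (X z) (Y z)) x = h x (D Z X x) (Y x) + h x (X x) (D Z Y x)"
    if "X \<in> vector_fields A" "Y \<in> vector_fields A" "Z \<in> vector_fields A" for X Y Z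
    using compat[OF that, of x] by (simp add: cov_deriv_metric_def)
  have t: "lie_bracket A X Y x + T x (X x) (Y x) = D X Y x - D Y X x"
    if "X \<in> vector_fields A" "Y \<in> vector_fields A" for X Y
    unfolding tors[OF that, of x, symmetric] torsion_def by simp
  show ?thesis
    unfolding koszul_def d[OF XYZ(2,3,1)] d[OF XYZ(1,3,2)] d[OF XYZ] t[OF XYZ(1,2)] t[OF XYZ(3,1)]
      t[OF XYZ(3,2)]
    by (simp add: h_simps h_sym[of x "Y x"] h_sym[of x "X x"])
qed

text \<open>
  In the chart selected at the point the derivatives of the third field cancel in the Koszul
  expression.  What remains, apart from the derivative of \<open>Y\<close> along \<open>X\<close>, is an algebraic form
  in the values of the three fields; representing it by \<open>h\<close> gives the Christoffel symbols.
\<close>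

definition christoffel_form :: "'m \<Rightarrow> 'e \<Rightarrow> 'e \<Rightarrow> 'e \<Rightarrow> real" where
  "christoffel_form x u w z =
      metric_deriv h x u w z + metric_deriv h x w u z - metric_deriv h x z u w
    + h x (T x u w) z + h x (T x z u) w + h x (T x z w) u"

definition christoffel :: "'m \<Rightarrow> 'e \<Rightarrow> 'e \<Rightarrow> 'e" where
  "christoffel x u w = (SOME v. \<forall>z. h x v z = christoffel_form x u w z / 2)"

lemma h_christoffel: "2 * h x (christoffel x u w) z = christoffel_form x u w z"
proof -
  have "linear (\<lambda>z. christoffel_form x u w z / 2)"
    unfolding christoffel_form_def
    by (rule linearI) (simp_all add: h_simps T_simps metric_deriv_simps field_simps)
  then have "\<exists>v. \<forall>z. h x v z = christoffel_form x u w z / 2"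
    by (intro nondegenerate_bilinear_represents bilinear_h) (rule nondegenerate)
  from someI_ex[OF this]
  have "h x (christoffel x u w) z = christoffel_form x u w z / 2"
    unfolding christoffel_def by blast
  then show ?thesis by simp
qed

lemma christoffel_eqI:
  assumes "\<And>z. 2 * h x v z = christoffel_form x u w z" shows "christoffel x u w = v"
proof (rule h_eqI)
  fix z
  show "h x (christoffel x u w) z = h x v z"
    using assms[of z] h_christoffel[of x u w z] by simp
qed

lemma christoffel_form_bilinear:
  "christoffel_form x (u + u') w z = christoffel_form x u w z + christoffel_form x u' w z"
  "christoffel_form x u (w + w') z = christoffel_form x u w z + christoffel_form x u w' z"
  "christoffel_form x (a *\<^sub>R u) w z = a * christoffel_form x u w z"
  "christoffel_form x u (a *\<^sub>R w) z = a * christoffel_form x u w z"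
  unfolding christoffel_form_def h_simps T_simps metric_deriv_simps by (simp_all add: algebra_simps)

lemma christoffel_bilinear:
  "christoffel x (u + u') w = christoffel x u w + christoffel x u' w"
  "christoffel x u (w + w') = christoffel x u w + christoffel x u w'"
  "christoffel x (a *\<^sub>R u) w = a *\<^sub>R christoffel x u w"
  "christoffel x u (a *\<^sub>R w) = a *\<^sub>R christoffel x u w"
proof -
  have scale: "2 * h x (a *\<^sub>R v) z = a * (2 * h x v z)" for v z by (simp add: h_simps)
  have add: "2 * h x (v + v') z = 2 * h x v z + 2 * h x v' z" for v v' z by (simp add: h_simps)
  show "christoffel x (u + u') w = christoffel x u w + christoffel x u' w"
    "christoffel x u (w + w') = christoffel x u w + christoffel x u w'"
    by (rule christoffel_eqI, simp only: add christoffel_form_bilinear h_christoffel)+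
  show "christoffel x (a *\<^sub>R u) w = a *\<^sub>R christoffel x u w"
    "christoffel x u (a *\<^sub>R w) = a *\<^sub>R christoffel x u w"
    by (rule christoffel_eqI, simp only: scale christoffel_form_bilinear h_christoffel)+
qed

definition koszul_connection :: "('m \<Rightarrow> 'e) \<Rightarrow> ('m \<Rightarrow> 'e) \<Rightarrow> 'm \<Rightarrow> 'e" where
  "koszul_connection X Y x = field_deriv Y x (X x) + christoffel x (X x) (Y x)"

lemma koszul_connection_torsion:
  "torsion A koszul_connection X Y x = T x (X x) (Y x)"
proof -
  have "christoffel x u w - christoffel x w u = T x u w" for u w
  proof (rule h_eqI)
    fix z
    have "2 * h x (christoffel x u w - christoffel x w u) z = h x (T x u w) z - h x (T x w u) z"
      unfolding linear_diff[OF linear_h_left] right_diff_distrib h_christoffel christoffel_form_def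
      by (simp add: metric_deriv_sym[of x z w u])
    also have "\<dots> = 2 * h x (T x u w) z"
      by (subst T_anti[of x w u]) (simp add: h_simps)
    finally show "h x (christoffel x u w - christoffel x w u) z = h x (T x u w) z" by simp
  qed
  from this[of "X x" "Y x"] show ?thesis
    by (simp add: torsion_def koszul_connection_def lie_bracket_eq algebra_simps)
qed

lemma koszul_connection_compatible:
  assumes "X \<in> vector_fields A" "Y \<in> vector_fields A"
  shows "cov_deriv_metric A koszul_connection Z h X Y x = 0"
proof -
  have "2 * h x (christoffel x v u) w + 2 * h x (christoffel x v w) u = 2 * metric_deriv h x v u w" for v u w
    unfolding h_christoffel christoffel_form_def
    by (subst T_anti[of x v u], subst T_anti[of x w u], subst T_anti[of x v w])
       (simp add: h_simps metric_deriv_sym[of x v w u])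
  from this[of "Z x" "X x" "Y x"]
  have "metric_deriv h x (Z x) (X x) (Y x) =
      h x (christoffel x (Z x) (X x)) (Y x) + h x (X x) (christoffel x (Z x) (Y x))"
    by (simp add: h_sym[of x "X x"])
  then show ?thesis
    by (simp add: cov_deriv_metric_def dir_deriv_metric[OF assms] koszul_connection_def h_simps)
qed

text \<open>
  The pointwise definition goes through the chart selected at each point, which may jump.
  Smoothness in a fixed chart is read off the Koszul identity instead: its right-hand side is a
  smooth function, and inserting for \<open>Z\<close> the cut-off coordinate fields gives a linear system with
  smooth coefficients for the components of \<open>\<nabla>\<^sub>X Y\<close>.  On the ball where the bump is positive the
  system is uniquely solvable because \<open>h\<close> is nondegenerate.
\<close>

lemma vector_field_koszul_connection:
  assumes X: "X \<in> vector_fields A" and Y: "Y \<in> vector_fields A"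
  shows "koszul_connection X Y \<in> vector_fields A" (is "?D \<in> _")
proof (rule vector_field_if_locally_smooth)
  fix x
  define c where "c = chart_at A x"
  have c: "c \<in> A" "x \<in> fst c" using chart_at by (auto simp: c_def)
  define p where "p = snd c x"
  obtain R where R: "R > 0" "cball p R \<subseteq> chart_image c"
    using open_contains_cball[of "chart_image c"] open_chart_image[OF c(1)] chart_image_in[OF c]
    unfolding p_def by blast
  have sub: "ball p R \<subseteq> chart_image c" using R(2) by auto
  define Z where "Z = bump_field c p R"
  have Z: "Z b \<in> vector_fields A" for b
    unfolding Z_def by (rule vector_field_bump_field[OF c(1) R])
  \<comment> \<open>\<open>H y w\<close> collects the pairings \<open>2 h(w, Z b)\<close>; the bump is the length of \<open>Z b\<close> relative to the
      coordinate field\<close>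
  define H where "H y w = (\<Sum>b\<in>Basis. (2 * bump p R y * metric_rep h c y w b) *\<^sub>R b)" for y w
  define K where "K y = (\<Sum>b\<in>Basis. koszul X Y (Z b) (chart_inv c y) *\<^sub>R b)" for y
  have K_smooth: "smooth_on (ball p R) K"
    unfolding K_def
    by (intro smooth_on_sum smooth_on_scaleR smooth_on_const open_ball
        smooth_on_subset[OF smooth_funD[OF smooth_fun_koszul[OF X Y Z] c(1)] sub])
  have H_smooth: "smooth_on (ball p R) (\<lambda>y. H y w)" for w
    unfolding H_def
    by (intro smooth_on_sum smooth_on_scaleR smooth_on_mult smooth_on_const smooth_on_bump open_ball
        smooth_on_subset[OF smooth_metric_rep[OF metric c(1)] sub])
  have H_linear: "linear (H y)" if y: "y \<in> ball p R" for y
  proof -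
    have "chart_inv c y \<in> fst c" using y sub c(1) by auto
    note lin = linear_coord_vector[OF c(1) this]
    show ?thesis
      unfolding H_def
      by (intro linearI) (simp_all add: linear_add[OF lin] linear_cmul[OF lin] h_simps algebra_simps
          sum.distrib scaleR_sum_right)
  qed
  have H_inj: "inj (H y)" if y: "y \<in> ball p R" for y
    unfolding linear_injective_0[OF H_linear[OF y]]
  proof (intro allI impI)
    fix w assume "H y w = 0"
    have yc: "y \<in> chart_image c" using y sub by blast
    let ?z = "chart_inv c y"
    have zc: "?z \<in> fst c" using yc c by simp
    have "bump p R y > 0" using y by (simp add: bump_pos)
    moreover have "H y w \<bullet> b = 2 * bump p R y * metric_rep h c y w b" if "b \<in> Basis" for b
      unfolding H_def using that by (rule inner_sum_left_Basis)
    ultimately have 0: "metric_rep h c y w b = 0" if "b \<in> Basis" for b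
      using \<open>H y w = 0\<close> that by fastforce
    have "linear (metric_rep h c y w)"
      using bilinear_metric_rep[OF metric c(1) yc] by (simp add: bilinear_def)
    then have "metric_rep h c y w v = 0" for v
      using linear_basis_expansion[of "metric_rep h c y w" v] 0 by simp
    from this[of "components A c ?z _"] have "h ?z (coord_vector A c w ?z) v = 0" for v
      using c(1) zc by simp
    then have "coord_vector A c w ?z = 0" by (rule nondegenerate)
    then show "w = 0"
      using components_coord_vector[OF c(1) c(1) zc zc, of w] linear_0[OF linear_components[OF c(1) zc]]
      by (simp add: jacobian_self c(1) zc)
  qed
  have "H y (local_rep A c ?D y) = K y" if y: "y \<in> ball p R" for y
  proof -
    let ?z = "chart_inv c y"
    have zc: "?z \<in> fst c" "y \<in> chart_image c" using y sub c by auto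
    have "2 * bump p R y * metric_rep h c y (local_rep A c ?D y) b = koszul X Y (Z b) ?z" for b
    proof -
      have "h ?z (?D ?z) (Z b ?z) = bump p R y * metric_rep h c y (local_rep A c ?D y) b"
        unfolding Z_def bump_field_def local_rep_def using zc c(1) by (simp add: h_simps)
      moreover have "2 * h ?z (?D ?z) (Z b ?z) = koszul X Y (Z b) ?z"
        by (rule koszul_if_compatible[OF koszul_connection_compatible koszul_connection_torsion X Y Z])
      ultimately show ?thesis by simp
    qed
    then show ?thesis by (simp add: H_def K_def)
  qed
  then have "smooth_on (ball p R) (local_rep A c ?D)"
    unfolding smooth_on_def
    using Ck_on_linear_system_solution[OF open_ball H_linear H_inj H_smooth] K_smooth
    unfolding smooth_on_def by blast
  then show "\<exists>c\<in>A. \<exists>U. x \<in> fst c \<and> open U \<and> snd c x \<in> U \<and> U \<subseteq> chart_image c \<and>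
      smooth_on U (local_rep A c ?D)"
    using c R(1) sub by (intro bexI[of _ c] exI[of _ "ball p R"]) (auto simp: p_def)
qed

text \<open>
  The restriction to vector fields is the representative required by the extensional function
  space to which linear connections belong.
\<close>

definition metric_connection :: "('m \<Rightarrow> 'e) \<Rightarrow> ('m \<Rightarrow> 'e) \<Rightarrow> 'm \<Rightarrow> 'e" where
  "metric_connection = (\<lambda>X\<in>vector_fields A. \<lambda>Y\<in>vector_fields A. koszul_connection X Y)"

lemma metric_connection_apply:
  "X \<in> vector_fields A \<Longrightarrow> Y \<in> vector_fields A \<Longrightarrow> metric_connection X Y = koszul_connection X Y"
  by (simp add: metric_connection_def)

lemma linear_connection_metric_connection: "linear_connection A metric_connection"
  unfolding linear_connection_def
proof (intro conjI ballI allI impI)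
  show "metric_connection \<in> vector_fields A \<rightarrow>\<^sub>E vector_fields A \<rightarrow>\<^sub>E vector_fields A"
    unfolding metric_connection_def by (intro restrict_PiE_iff[THEN iffD2] ballI vector_field_koszul_connection)
qed (simp_all add: metric_connection_apply vector_field_add vector_field_scaleR koszul_connection_def
      field_deriv_add field_deriv_scaleR christoffel_bilinear linear_add[OF linear_field_deriv]
      linear_cmul[OF linear_field_deriv] algebra_simps)

lemma metric_connection_torsion:
  "X \<in> vector_fields A \<Longrightarrow> Y \<in> vector_fields A \<Longrightarrow> torsion A metric_connection X Y x = T x (X x) (Y x)"
  using koszul_connection_torsion[of X Y x] by (simp add: torsion_def metric_connection_apply)

lemma metric_connection_compatible:
  "X \<in> vector_fields A \<Longrightarrow> Y \<in> vector_fields A \<Longrightarrow> Z \<in> vector_fields A \<Longrightarrow>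
    cov_deriv_metric A metric_connection Z h X Y x = 0"
  using koszul_connection_compatible[of X Y Z x] by (simp add: cov_deriv_metric_def metric_connection_apply)

lemma metric_connection_unique:
  assumes D: "linear_connection A D"
    and compat: "\<And>X Y Z x. X \<in> vector_fields A \<Longrightarrow> Y \<in> vector_fields A \<Longrightarrow> Z \<in> vector_fields A \<Longrightarrow>
      cov_deriv_metric A D Z h X Y x = 0"
    and tors: "\<And>X Y x. X \<in> vector_fields A \<Longrightarrow> Y \<in> vector_fields A \<Longrightarrow>
      torsion A D X Y x = T x (X x) (Y x)"
  shows "D = metric_connection"
proof (rule PiE_ext)
  show D_PiE: "D \<in> vector_fields A \<rightarrow>\<^sub>E vector_fields A \<rightarrow>\<^sub>E vector_fields A"
    using D by (simp add: linear_connection_def)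
  show M_PiE: "metric_connection \<in> vector_fields A \<rightarrow>\<^sub>E vector_fields A \<rightarrow>\<^sub>E vector_fields A"
    using linear_connection_metric_connection by (simp add: linear_connection_def)
  fix X assume X: "X \<in> vector_fields A"
  show "D X = metric_connection X"
  proof (rule PiE_ext[OF PiE_mem[OF D_PiE X] PiE_mem[OF M_PiE X]])
    fix Y assume Y: "Y \<in> vector_fields A"
    show "D X Y = metric_connection X Y"
    proof (rule ext, rule h_eqI_fields)
      fix x Z assume Z: "Z \<in> vector_fields A"
      have "2 * h x (D X Y x) (Z x) = koszul X Y Z x"
        by (rule koszul_if_compatible[OF compat tors X Y Z])
      moreover have "2 * h x (metric_connection X Y x) (Z x) = koszul X Y Z x"
        by (rule koszul_if_compatible[OF metric_connection_compatible metric_connection_torsion X Y Z])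
      ultimately show "h x (D X Y x) (Z x) = h x (metric_connection X Y x) (Z x)" by simp
    qed
  qed
qed

end

section \<open>Light-like manifolds with trivialised radical\<close>

locale radical_frame = smooth_atlas A
  for A :: "('m::{t2_space, second_countable_topology}, 'e::euclidean_space) chart set" +
  fixes g :: "'m \<Rightarrow> 'e \<Rightarrow> 'e \<Rightarrow> real" and r :: nat
    and \<xi> :: "nat \<Rightarrow> 'm \<Rightarrow> 'e" and \<tau> :: "nat \<Rightarrow> 'm \<Rightarrow> 'e \<Rightarrow> real"
  assumes g: "symmetric_tensor_field A g"
    and dim_Rad: "dim (Rad g x) = r"
    and \<xi>: "i \<in> {1..r} \<Longrightarrow> \<xi> i \<in> Rad_sections A g"
    and \<xi>_independent: "inj_on (\<lambda>i. \<xi> i x) {1..r}" "independent ((\<lambda>i. \<xi> i x) ` {1..r})"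
    and \<tau>: "i \<in> {1..r} \<Longrightarrow> one_form A (\<tau> i)"
    and dual: "i \<in> {1..r} \<Longrightarrow> j \<in> {1..r} \<Longrightarrow> \<tau> i x (\<xi> j x) = (if i = j then 1 else 0)"
begin

text \<open>
  The forms \<open>\<tau>\<^sub>i\<close> fill in the radical: \<open>h = g + \<Sum>\<^sub>i \<tau>\<^sub>i \<otimes> \<tau>\<^sub>i\<close> is nondegenerate, \<open>\<xi>\<^sub>i\<close> is the vector
  field that \<open>h\<close> makes dual to \<open>\<tau>\<^sub>i\<close>, and a connection for which \<open>g\<close> and all \<open>\<tau>\<^sub>i\<close> are parallel is
  compatible with \<open>h\<close>.
\<close>

definition completed_metric :: "'m \<Rightarrow> 'e \<Rightarrow> 'e \<Rightarrow> real" where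
  "completed_metric x u w = g x u w + (\<Sum>i\<in>{1..r}. \<tau> i x u * \<tau> i x w)"

lemma linear_\<tau>: "i \<in> {1..r} \<Longrightarrow> linear (\<tau> i x)"
  using \<tau> by (simp add: one_form_def)

lemma linear_g: "linear (g x u)" "linear (\<lambda>u. g x u w)" and g_sym: "g x u w = g x w u"
  using g by (auto simp: symmetric_tensor_field_def bilinear_def)

lemma vector_field_\<xi>: "i \<in> {1..r} \<Longrightarrow> \<xi> i \<in> vector_fields A"
  using \<xi> by (simp add: Rad_sections_def)

lemma g_\<xi>: "i \<in> {1..r} \<Longrightarrow> g x (\<xi> i x) w = 0"
  using \<xi> by (simp add: Rad_sections_def Rad_def)

lemma completed_metric_sym: "completed_metric x u w = completed_metric x w u"
  unfolding completed_metric_def by (simp add: g_sym[of x u w] mult.commute)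

lemma symmetric_completed_metric: "symmetric_tensor_field A completed_metric"
proof -
  have \<tau>_smooth: "smooth_on (chart_image c) (\<lambda>y. \<tau> i (chart_inv c y) (coord_vector A c v (chart_inv c y)))"
    if "i \<in> {1..r}" "c \<in> A" for i c v
    using \<tau>[OF that(1)] that(2) unfolding one_form_def comp_def by blast
  have lin: "linear (completed_metric x u)" for x u
  proof -
    have "linear (\<lambda>w. \<tau> i x u * \<tau> i x w)" if "i \<in> {1..r}" for i
      using linear_compose_scale_right[OF linear_\<tau>[OF that], of "\<tau> i x u" x] by simp
    then have "linear (\<lambda>w. \<Sum>i\<in>{1..r}. \<tau> i x u * \<tau> i x w)"
      by (intro linear_compose_sum ballI)
    from linear_compose_add[OF linear_g(1) this] show ?thesis
      unfolding completed_metric_def[abs_def] .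
  qed
  then have "linear (\<lambda>u. completed_metric x u w)" for x w
    unfolding completed_metric_sym[of x _ w] .
  moreover have "smooth_on (chart_image c) ((\<lambda>x. completed_metric x (coord_vector A c u x) (coord_vector A c w x))
      \<circ> chart_inv c)" if c: "c \<in> A" for c u w
    unfolding completed_metric_def comp_def
    by (intro smooth_on_add smooth_on_sum smooth_on_mult open_chart_image[OF c]
        smooth_metric_rep[OF g c] \<tau>_smooth c)
  ultimately show ?thesis
    using lin completed_metric_sym unfolding symmetric_tensor_field_def bilinear_def by blast
qed

lemma completed_metric_\<xi>:
  assumes i: "i \<in> {1..r}" shows "completed_metric x (\<xi> i x) w = \<tau> i x w"
proof -
  have "(\<Sum>j\<in>{1..r}. \<tau> j x (\<xi> i x) * \<tau> j x w) = (\<Sum>j\<in>{1..r}. if j = i then \<tau> j x w else 0)"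
    by (rule sum.cong) (auto simp: dual[OF _ i])
  then show ?thesis using i by (simp add: completed_metric_def g_\<xi>[OF i])
qed

text \<open>
  By dimension the \<open>\<xi>\<^sub>i\<close> span the radical, and duality identifies the coefficients.
\<close>

lemma Rad_expansion:
  assumes "v \<in> Rad g x" shows "v = (\<Sum>i\<in>{1..r}. \<tau> i x v *\<^sub>R \<xi> i x)"
proof -
  let ?B = "(\<lambda>i. \<xi> i x) ` {1..r}"
  have "Rad g x \<subseteq> span ?B"
  proof (rule card_ge_dim_independent)
    show "?B \<subseteq> Rad g x" using g_\<xi> by (auto simp: Rad_def)
    show "dim (Rad g x) \<le> card ?B" unfolding dim_Rad card_image[OF \<xi>_independent(1)] by simp
  qed (rule \<xi>_independent(2))
  then have v: "v \<in> span ?B" using assms by blast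
  define f where "f v = v - (\<Sum>i\<in>{1..r}. \<tau> i x v *\<^sub>R \<xi> i x)" for v
  have "linear (\<lambda>v. \<tau> i x v *\<^sub>R \<xi> i x)" if "i \<in> {1..r}" for i
    by (intro linearI) (simp_all add: linear_add[OF linear_\<tau>[OF that]] linear_cmul[OF linear_\<tau>[OF that]]
        scaleR_add_left)
  then have "linear f"
    unfolding f_def by (intro linear_compose_sub linear_ident linear_compose_sum ballI)
  moreover have "f w = 0" if w: "w \<in> ?B" for w
  proof -
    obtain j where j: "j \<in> {1..r}" "w = \<xi> j x" using w by blast
    have "(\<Sum>i\<in>{1..r}. \<tau> i x w *\<^sub>R \<xi> i x) = (\<Sum>i\<in>{1..r}. if i = j then \<xi> i x else 0)"
      by (rule sum.cong) (auto simp: j(2) dual[OF _ j(1)])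
    then show ?thesis using j by (simp add: f_def)
  qed
  ultimately have "f v = 0" using v by (rule linear_eq_0_on_span)
  then show ?thesis by (simp add: f_def)
qed

text \<open>
  Pairing \<open>v\<close> with \<open>\<xi>\<^sub>i\<close> gives \<open>\<tau>\<^sub>i v = 0\<close>, hence \<open>v\<close> lies in the radical of \<open>g\<close>, where the \<open>\<tau>\<^sub>i\<close> are
  coordinates.
\<close>

lemma completed_metric_nondegenerate:
  assumes "\<And>w. completed_metric x v w = 0" shows "v = 0"
proof -
  have \<tau>_v: "\<tau> i x v = 0" if "i \<in> {1..r}" for i
    using completed_metric_\<xi>[OF that, of x v] assms[of "\<xi> i x"] completed_metric_sym by simp
  have "g x v w = 0" for w
    using assms[of w] by (simp add: completed_metric_def \<tau>_v)
  then have "v \<in> Rad g x" by (simp add: Rad_def)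
  from Rad_expansion[OF this] show ?thesis by (simp add: \<tau>_v)
qed

text \<open>
  The vectors \<open>u\<close> and \<open>w\<close> stand for \<open>\<nabla>\<^sub>Z X\<close> and \<open>\<nabla>\<^sub>Z Y\<close>, or for \<open>[Z, X]\<close> and \<open>[Z, Y]\<close>: the covariant
  and the Lie derivative of \<open>h\<close> both come from this one product rule.
\<close>

lemma derivative_completed_metric:
  assumes X: "X \<in> vector_fields A" and Y: "Y \<in> vector_fields A"
  shows "dir_deriv A Z (\<lambda>z. completed_metric z (X z) (Y z)) x
      - completed_metric x u (Y x) - completed_metric x (X x) w =
    dir_deriv A Z (\<lambda>z. g z (X z) (Y z)) x - g x u (Y x) - g x (X x) w
      + (\<Sum>i\<in>{1..r}. (dir_deriv A Z (\<lambda>z. \<tau> i z (X z)) x - \<tau> i x u) * \<tau> i x (Y x)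
          + \<tau> i x (X x) * (dir_deriv A Z (\<lambda>z. \<tau> i z (Y z)) x - \<tau> i x w))"
proof -
  have sm: "smooth_fun A (\<lambda>z. \<tau> i z (V z))" if "i \<in> {1..r}" "V \<in> vector_fields A" for i V
    by (rule smooth_fun_one_form[OF \<tau>[OF that(1)] that(2)])
  have "dir_deriv A Z (\<lambda>z. \<Sum>i\<in>{1..r}. \<tau> i z (X z) * \<tau> i z (Y z)) x =
      (\<Sum>i\<in>{1..r}. dir_deriv A Z (\<lambda>z. \<tau> i z (X z) * \<tau> i z (Y z)) x)"
    by (rule dir_deriv_sum) (intro smooth_fun_mult sm X Y)
  also have "\<dots> = (\<Sum>i\<in>{1..r}. dir_deriv A Z (\<lambda>z. \<tau> i z (X z)) x * \<tau> i x (Y x)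
          + \<tau> i x (X x) * dir_deriv A Z (\<lambda>z. \<tau> i z (Y z)) x)"
    by (intro sum.cong refl dir_deriv_mult sm X Y)
  finally have "dir_deriv A Z (\<lambda>z. completed_metric z (X z) (Y z)) x =
      dir_deriv A Z (\<lambda>z. g z (X z) (Y z)) x
      + (\<Sum>i\<in>{1..r}. dir_deriv A Z (\<lambda>z. \<tau> i z (X z)) x * \<tau> i x (Y x)
          + \<tau> i x (X x) * dir_deriv A Z (\<lambda>z. \<tau> i z (Y z)) x)"
    unfolding completed_metric_def
    by (subst dir_deriv_add[OF smooth_fun_metric[OF g X Y]])
       (auto intro!: smooth_fun_sum smooth_fun_mult sm X Y)
  then show ?thesis
    by (simp add: completed_metric_def sum.distrib sum_subtractf algebra_simps)
qed

lemma cov_deriv_completed_metric: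
  assumes "X \<in> vector_fields A" "Y \<in> vector_fields A"
  shows "cov_deriv_metric A D Z completed_metric X Y x = cov_deriv_metric A D Z g X Y x
      + (\<Sum>i\<in>{1..r}. cov_deriv_form A D Z (\<tau> i) X x * \<tau> i x (Y x)
          + \<tau> i x (X x) * cov_deriv_form A D Z (\<tau> i) Y x)"
  unfolding cov_deriv_metric_def cov_deriv_form_def by (rule derivative_completed_metric[OF assms])

end

locale adapted_torsion = radical_frame A g r \<xi> \<tau>
  for A :: "('m::{t2_space, second_countable_topology}, 'e::euclidean_space) chart set"
    and g r \<xi> \<tau> +
  fixes T :: "'m \<Rightarrow> 'e \<Rightarrow> 'e \<Rightarrow> 'e"
  assumes T: "torsion_tensor A T"
    and ext_deriv_\<tau>: "X \<in> vector_fields A \<Longrightarrow> Y \<in> vector_fields A \<Longrightarrow> i \<in> {1..r} \<Longrightarrow>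
      ext_deriv A (\<tau> i) X Y x = \<tau> i x (T x (X x) (Y x))"
    and lie_deriv_g: "X \<in> vector_fields A \<Longrightarrow> Y \<in> vector_fields A \<Longrightarrow> i \<in> {1..r} \<Longrightarrow>
      lie_deriv_metric A (\<xi> i) g X Y x = g x (X x) (T x (\<xi> i x) (Y x)) + g x (Y x) (T x (\<xi> i x) (X x))"
begin

sublocale metric_with_torsion A completed_metric T
  by unfold_locales (rule symmetric_completed_metric completed_metric_nondegenerate T; assumption?)+

text \<open>
  Since \<open>\<tau>\<^sub>j(\<xi>\<^sub>i)\<close> is constant, the Lie derivative of \<open>\<tau>\<^sub>j\<close> along \<open>\<xi>\<^sub>i\<close> is \<open>d\<tau>\<^sub>j(\<xi>\<^sub>i, -)\<close>, that is,
  \<open>\<tau>\<^sub>j(T(\<xi>\<^sub>i, -))\<close>.  So the hypothesis on the Lie derivative of \<open>g\<close> carries over to \<open>h\<close>.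
\<close>

lemma lie_deriv_completed_metric:
  assumes X: "X \<in> vector_fields A" and Y: "Y \<in> vector_fields A" and i: "i \<in> {1..r}"
  shows "lie_deriv_metric A (\<xi> i) completed_metric X Y x =
    completed_metric x (X x) (T x (\<xi> i x) (Y x)) + completed_metric x (Y x) (T x (\<xi> i x) (X x))"
proof -
  have \<tau>: "dir_deriv A (\<xi> i) (\<lambda>z. \<tau> j z (V z)) x - \<tau> j x (lie_bracket A (\<xi> i) V x) = \<tau> j x (T x (\<xi> i x) (V x))"
    if j: "j \<in> {1..r}" and V: "V \<in> vector_fields A" for j V
    using ext_deriv_\<tau>[OF vector_field_\<xi>[OF i] V j, of x] by (simp add: ext_deriv_def dual[OF j i])
  have "lie_deriv_metric A (\<xi> i) completed_metric X Y x = lie_deriv_metric A (\<xi> i) g X Y x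
      + (\<Sum>j\<in>{1..r}. \<tau> j x (T x (\<xi> i x) (X x)) * \<tau> j x (Y x) + \<tau> j x (X x) * \<tau> j x (T x (\<xi> i x) (Y x)))"
    unfolding lie_deriv_metric_def derivative_completed_metric[OF X Y]
    by (simp add: \<tau>[OF _ X] \<tau>[OF _ Y])
  then show ?thesis
    by (simp add: lie_deriv_g[OF X Y i] completed_metric_def sum.distrib mult.commute)
qed

text \<open>
  The central computation.  In the Koszul expression for \<open>2 h(\<nabla>\<^sub>X \<xi>, Z)\<close> the terms group into
  \<open>d\<tau>(X, Z) - \<tau>(T(X, Z))\<close> and the difference of the two sides of the formula for the Lie
  derivative of \<open>h\<close> along \<open>\<xi>\<close>; both vanish by hypothesis.
\<close>

lemma koszul_connection_\<xi>:
  assumes X: "X \<in> vector_fields A" and i: "i \<in> {1..r}"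
  shows "koszul_connection X (\<xi> i) x = 0"
proof (rule h_eqI_fields)
  fix Z assume Z: "Z \<in> vector_fields A"
  let ?h = completed_metric and ?\<xi> = "\<xi> i"
  note \<xi>' = vector_field_\<xi>[OF i]
  have h_\<xi>: "?h z u (?\<xi> z) = \<tau> i z u" "?h z (?\<xi> z) u = \<tau> i z u" for z u
    using completed_metric_\<xi>[OF i] completed_metric_sym by simp_all
  have anti: "lie_bracket A V W x = - lie_bracket A W V x" for V W
    by (simp add: lie_bracket_eq)
  have "2 * ?h x (koszul_connection X ?\<xi> x) (Z x) = koszul X ?\<xi> Z x"
    by (rule koszul_if_compatible[OF koszul_connection_compatible koszul_connection_torsion X \<xi>' Z])
  also have "\<dots> = (ext_deriv A (\<tau> i) X Z x + \<tau> i x (T x (Z x) (X x)))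
      + (lie_deriv_metric A ?\<xi> ?h X Z x + ?h x (T x (X x) (?\<xi> x)) (Z x) + ?h x (T x (Z x) (?\<xi> x)) (X x))"
    unfolding koszul_def h_\<xi> ext_deriv_def lie_deriv_metric_def
    unfolding anti[of X ?\<xi>] anti[of Z ?\<xi>] anti[of Z X]
    by (simp add: h_simps h_\<xi> h_sym[of x "X x"] linear_add[OF linear_\<tau>[OF i]] linear_diff[OF linear_\<tau>[OF i]]
        linear_neg[OF linear_\<tau>[OF i]])
  also have "\<dots> = 0"
    unfolding ext_deriv_\<tau>[OF X Z i] lie_deriv_completed_metric[OF X Z i]
      T_anti[of x "Z x" "X x"] T_anti[of x "X x" "?\<xi> x"] T_anti[of x "Z x" "?\<xi> x"]
    by (simp add: h_simps linear_neg[OF linear_\<tau>[OF i]] h_sym[of x "X x"] h_sym[of x "Z x"])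
  finally show "?h x (koszul_connection X ?\<xi> x) (Z x) = ?h x 0 (Z x)" by (simp add: h_simps)
qed

text \<open>As \<open>\<tau>\<^sub>i = h(\<xi>\<^sub>i, -)\<close> with \<open>h\<close> and \<open>\<xi>\<^sub>i\<close> parallel, \<open>\<tau>\<^sub>i\<close> is parallel.\<close>

lemma metric_connection_parallel_\<tau>:
  assumes X: "X \<in> vector_fields A" and Y: "Y \<in> vector_fields A" and i: "i \<in> {1..r}"
  shows "cov_deriv_form A metric_connection X (\<tau> i) Y x = 0"
  using metric_connection_compatible[OF vector_field_\<xi>[OF i] Y X, of x]
  by (simp add: cov_deriv_metric_def cov_deriv_form_def metric_connection_apply X Y vector_field_\<xi>[OF i]
      koszul_connection_\<xi>[OF X i] completed_metric_\<xi>[OF i] h_simps)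

lemma metric_connection_parallel_g:
  assumes X: "X \<in> vector_fields A" and Y: "Y \<in> vector_fields A" and Z: "Z \<in> vector_fields A"
  shows "cov_deriv_metric A metric_connection Z g X Y x = 0"
  using metric_connection_compatible[OF X Y Z, of x] cov_deriv_completed_metric[OF X Y, of metric_connection Z x]
  by (simp add: metric_connection_parallel_\<tau>[OF Z X] metric_connection_parallel_\<tau>[OF Z Y])

end

theorem corollary1p5:
  fixes A :: "('m::{t2_space, second_countable_topology}, 'e::euclidean_space) chart set"
    and g :: "'m \<Rightarrow> 'e \<Rightarrow> 'e \<Rightarrow> real"
    and q r :: nat
    and \<xi> :: "nat \<Rightarrow> 'm \<Rightarrow> 'e"
    and \<tau> :: "nat \<Rightarrow> 'm \<Rightarrow> 'e \<Rightarrow> real"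
    and T :: "'m \<Rightarrow> 'e \<Rightarrow> 'e \<Rightarrow> 'e"
  assumes "light_like_manifold A g q r"
    and "\<forall>i\<in>{1..r}. \<xi> i \<in> Rad_sections A g"
    and "\<forall>x. inj_on (\<lambda>i. \<xi> i x) {1..r} \<and> independent ((\<lambda>i. \<xi> i x) ` {1..r})"
    and "\<forall>i\<in>{1..r}. one_form A (\<tau> i)"
    and "\<forall>i\<in>{1..r}. \<forall>j\<in>{1..r}. \<forall>x. \<tau> i x (\<xi> j x) = (if i = j then 1 else 0)"
    and "torsion_tensor A T"
    and "\<forall>X\<in>vector_fields A. \<forall>Y\<in>vector_fields A. \<forall>i\<in>{1..r}. \<forall>x.
           ext_deriv A (\<tau> i) X Y x = \<tau> i x (T x (X x) (Y x))"
    and "\<forall>X\<in>vector_fields A. \<forall>Y\<in>vector_fields A. \<forall>i\<in>{1..r}. \<forall>x.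
           lie_deriv_metric A (\<xi> i) g X Y x
           = g x (X x) (T x (\<xi> i x) (Y x)) + g x (Y x) (T x (\<xi> i x) (X x))"
  shows "\<exists>!D. linear_connection A D \<and>
           (\<forall>X\<in>vector_fields A. \<forall>Y\<in>vector_fields A. \<forall>Z\<in>vector_fields A. \<forall>x.
              cov_deriv_metric A D Z g X Y x = 0) \<and>
           (\<forall>X\<in>vector_fields A. \<forall>Y\<in>vector_fields A. \<forall>x.
              torsion A D X Y x = T x (X x) (Y x)) \<and>
           (\<forall>i\<in>{1..r}. \<forall>X\<in>vector_fields A. \<forall>Y\<in>vector_fields A. \<forall>x.
              cov_deriv_form A D X (\<tau> i) Y x = 0)"
proof -
  have "smooth_manifold A" "symmetric_tensor_field A g" "\<And>x. dim (Rad g x) = r"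
    using assms(1) by (auto simp: light_like_manifold_def)
  then interpret adapted_torsion A g r \<xi> \<tau> T
    using assms(2-8) by unfold_locales blast+
  show ?thesis
  proof (rule ex1I[of _ metric_connection], intro conjI ballI allI)
    fix D
    assume D: "linear_connection A D \<and>
      (\<forall>X\<in>vector_fields A. \<forall>Y\<in>vector_fields A. \<forall>Z\<in>vector_fields A. \<forall>x.
        cov_deriv_metric A D Z g X Y x = 0) \<and>
      (\<forall>X\<in>vector_fields A. \<forall>Y\<in>vector_fields A. \<forall>x. torsion A D X Y x = T x (X x) (Y x)) \<and>
      (\<forall>i\<in>{1..r}. \<forall>X\<in>vector_fields A. \<forall>Y\<in>vector_fields A. \<forall>x. cov_deriv_form A D X (\<tau> i) Y x = 0)"
    show "D = metric_connection"
    proof (rule metric_connection_unique)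
      show "cov_deriv_metric A D Z completed_metric X Y x = 0"
        if "X \<in> vector_fields A" "Y \<in> vector_fields A" "Z \<in> vector_fields A" for X Y Z x
        using D that by (simp add: cov_deriv_completed_metric)
    qed (use D in blast)+
  qed (simp_all add: linear_connection_metric_connection metric_connection_parallel_g
      metric_connection_torsion metric_connection_parallel_\<tau>)
qed

end
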